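(* For a $\{0,1\}$-separable totally disconnected space $X$, the following characterizations hold: (1) $C_{\downarrow F}(X,\{0,1\})$ is Baire if and only if $X$ has $\mathsf{DMOP}$ and $X'^\circ=\emptyset$; (2) $C_{\downarrow F}(X,\{0,1\})$ is meager if and only if $X$ does not have $\mathsf{DMOP}$ or $\overline{X'^\circ}$ is not compact; (3) $C_{\downarrow F}(X,\{0,1\})$ is neither Baire nor meager if and only if $X$ has $\mathsf{DMOP}$ and the set $\overline{X'^\circ}$ is compact and not empty.
   Context: Fell hypograph topology: $C(X,Y)$ is the set of continuous functions $X\to Y$. $C_{\downarrow F}(X,Y)$ (for $Y\subset\mathbb R$) is $C(X,Y)$ endowed with the Fell hypograph topology: identify $f$ with its hypograph ${\downarrow}f=\{(x,y)\in X\times\mathbb R:y\le f(x)\}$ and take the topology inherited from the set of closed subsets of $X\times\mathbb R$ with the Fell topology (for a space $Z$ the Fell topology on closed subsets of $Z$ is generated by the subbase of sets $\{F:F\cap U\ne\emptyset\}$, $U\subset Z$ open, and $\{F:F\subset Z\setminus K\}$, $K\subset Z$ compact). For Hausdorff $X$ it is generated by the subbase of sets $\{f:\sup f(U)>y\}$ and $\{f:\max f(K)<y\}$, where $U\subset X$ is non-empty open, $K\subset X$ is non-empty compact and $y\in\mathbb R$. In this statement $X$ is called totally disconnected if for any distinct $x_1,x_2\in X$ and any $y_1,y_2\in\{0,1\}$ there is a continuous $f:X\to\{0,1\}$ with $f(x_i)=y_i$ for $i=1,2$. A point $x\in X$ is isolated if $\{x\}$ is clopen in $X$; $\dot X$ is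 the set of isolated points, $X'=X\setminus\dot X$, $X'^\circ$ is the interior of $X'$ in $X$, and $\overline{X'^\circ}$ is the closure of $X'^\circ$ in $X$. The $\{0,1\}$-topology on $X$ is the weakest topology making all continuous functions $X\to\{0,1\}$ continuous (i.e. the topology generated by the clopen subsets of $X$); $\overline{A}^{\{0,1\}}$ is the closure of $A\subset X$ in it. $X$ is $\{0,1\}$-separable if it contains a $\sigma$-compact subset $M$, meager in $X$, with $X'=\overline{M}^{\{0,1\}}$. A family $\mathcal F$ of subsets of $X$ is discrete if each point of $X$ has a neighborhood meeting at most one set of $\mathcal F$; it is a moving off family if for any compact $K\subset X$ there is a non-empty $F\in\mathcal F$ with $F\cap K=\emptyset$. $X$ has $\mathsf{DMOP}$ if every moving off family of finite subsets of $\dot X$ contains an infinite subfamily that is discrete in $X$. A space is Baire if every countable intersection of open dense subsets is dense; meager if it is a countable union of nowhere dense subsets. *)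

theory Defs
  imports "HOL-Analysis.Analysis"
begin

section \<open>Baire category\<close>

definition nowhere_dense_in :: "'a topology \<Rightarrow> 'a set \<Rightarrow> bool" where
  "nowhere_dense_in X A \<longleftrightarrow> A \<subseteq> topspace X \<and> X interior_of (X closure_of A) = {}"

definition meager_in :: "'a topology \<Rightarrow> 'a set \<Rightarrow> bool" where
  "meager_in X A \<longleftrightarrow> (\<exists>N :: nat \<Rightarrow> 'a set. (\<forall>n. nowhere_dense_in X (N n)) \<and> A = (\<Union>n. N n))"

definition meager_space :: "'a topology \<Rightarrow> bool" where
  "meager_space X \<longleftrightarrow> meager_in X (topspace X)"

definition Baire_space :: "'a topology \<Rightarrow> bool" where
  "Baire_space X \<longleftrightarrow>
    (\<forall>G :: nat \<Rightarrow> 'a set. (\<forall>n. openin X (G n) \<and> X closure_of (G n) = topspace X)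
        \<longrightarrow> X closure_of (\<Inter>n. G n) = topspace X)"

section \<open>The Fell hypograph topology\<close>

definition fell_topology :: "'a topology \<Rightarrow> 'a set topology" where
  "fell_topology Z = topology_generated_by
     ({{F. closedin Z F \<and> F \<inter> U \<noteq> {}} | U. openin Z U} \<union>
      {{F. closedin Z F \<and> F \<subseteq> topspace Z - K} | K. compactin Z K})"

text \<open>Continuous functions \<open>X \<rightarrow> Y\<close> are represented by their extensional versions, so that each of
  them corresponds to exactly one HOL function.\<close>

definition continuous_funs :: "'a topology \<Rightarrow> real set \<Rightarrow> ('a \<Rightarrow> real) set" where
  "continuous_funs X Y = {f \<in> extensional (topspace X). continuous_map X (top_of_set Y) f}"

definition hypograph :: "'a topology \<Rightarrow> ('a \<Rightarrow> real) \<Rightarrow> ('a \<times> real) set" where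
  "hypograph X f = {(x, y). x \<in> topspace X \<and> y \<le> f x}"

definition fell_hypograph_space :: "'a topology \<Rightarrow> real set \<Rightarrow> ('a \<Rightarrow> real) topology" where
  "fell_hypograph_space X Y =
     pullback_topology (continuous_funs X Y) (hypograph X)
       (fell_topology (prod_topology X euclideanreal))"

lemma topspace_fell_topology: "topspace (fell_topology Z) = {F. closedin Z F}"
proof (rule equalityI)
  show "topspace (fell_topology Z) \<subseteq> {F. closedin Z F}"
    unfolding fell_topology_def topology_generated_by_topspace by auto
  have "{F. closedin Z F} = {F. closedin Z F \<and> F \<subseteq> topspace Z - {}}"
    using closedin_subset by auto
  then have "{F. closedin Z F} \<in> {{F. closedin Z F \<and> F \<subseteq> topspace Z - K} | K. compactin Z K}"
    by (intro CollectI exI[of _ "{}"] conjI) simp_all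
  then show "{F. closedin Z F} \<subseteq> topspace (fell_topology Z)"
    unfolding fell_topology_def topology_generated_by_topspace
    by (intro Union_upper UnI2)
qed

lemma closedin_hypograph:
  assumes "f \<in> continuous_funs X Y"
  shows "closedin (prod_topology X euclideanreal) (hypograph X f)"
proof -
  have f: "continuous_map X euclideanreal f"
    using assms continuous_map_into_fulltopology by (auto simp: continuous_funs_def)
  have "continuous_map (prod_topology X euclideanreal) euclideanreal (f \<circ> fst)"
    using continuous_map_compose[OF continuous_map_fst f] .
  then have "continuous_map (prod_topology X euclideanreal) euclideanreal (\<lambda>p. f (fst p) - snd p)"
    by (intro continuous_map_diff continuous_map_snd) (auto simp: o_def)
  then have "closedin (prod_topology X euclideanreal)
      {p \<in> topspace (prod_topology X euclideanreal). f (fst p) - snd p \<in> {0..}}"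
    by (rule closedin_continuous_map_preimage) auto
  moreover have "{p \<in> topspace (prod_topology X euclideanreal). f (fst p) - snd p \<in> {0..}}
      = hypograph X f"
    by (auto simp: hypograph_def)
  ultimately show ?thesis by simp
qed

lemma topspace_fell_hypograph_space:
  "topspace (fell_hypograph_space X Y) = continuous_funs X Y"
  unfolding fell_hypograph_space_def topspace_pullback_topology topspace_fell_topology
  using closedin_hypograph by blast

section \<open>Properties of the domain space\<close>

text \<open>This is separation of points by clopen sets, which is stronger than
  having only singletons as connected components.\<close>

definition totally_disconnected_space :: "'a topology \<Rightarrow> bool" where
  "totally_disconnected_space X \<longleftrightarrow>
    (\<forall>x1 \<in> topspace X. \<forall>x2 \<in> topspace X. x1 \<noteq> x2 \<longrightarrow>
      (\<forall>y1 \<in> {0, 1}. \<forall>y2 \<in> {0, 1}.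
        \<exists>f. continuous_map X (top_of_set {0, 1 :: real}) f \<and> f x1 = y1 \<and> f x2 = y2))"

definition isolated_points :: "'a topology \<Rightarrow> 'a set" where
  "isolated_points X = {x \<in> topspace X. openin X {x} \<and> closedin X {x}}"

definition nonisolated_points :: "'a topology \<Rightarrow> 'a set" where
  "nonisolated_points X = topspace X - isolated_points X"

definition zero_one_topology :: "'a topology \<Rightarrow> 'a topology" where
  "zero_one_topology X = topology_generated_by
     {{x \<in> topspace X. f x \<in> V} | f V.
        continuous_map X (top_of_set {0, 1 :: real}) f \<and> openin (top_of_set {0, 1}) V}"

lemma topspace_zero_one_topology: "topspace (zero_one_topology X) = topspace X"
proof (rule equalityI)
  show "topspace (zero_one_topology X) \<subseteq> topspace X"
    unfolding zero_one_topology_def topology_generated_by_topspace by auto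
  have "topspace X \<in> {{x \<in> topspace X. f x \<in> V} | f V.
      continuous_map X (top_of_set {0, 1 :: real}) f \<and> openin (top_of_set {0, 1}) V}"
    by (intro CollectI exI[of _ "\<lambda>x. 0"] exI[of _ "{0, 1}"] conjI) simp_all
  then show "topspace X \<subseteq> topspace (zero_one_topology X)"
    unfolding zero_one_topology_def topology_generated_by_topspace
    by (rule Union_upper)
qed

definition sigma_compact_in :: "'a topology \<Rightarrow> 'a set \<Rightarrow> bool" where
  "sigma_compact_in X M \<longleftrightarrow> (\<exists>K :: nat \<Rightarrow> 'a set. (\<forall>n. compactin X (K n)) \<and> M = (\<Union>n. K n))"

definition zero_one_separable :: "'a topology \<Rightarrow> bool" where
  "zero_one_separable X \<longleftrightarrow>
    (\<exists>M. M \<subseteq> topspace X \<and> sigma_compact_in X M \<and> meager_in X M \<and>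
         nonisolated_points X = zero_one_topology X closure_of M)"

definition discrete_family :: "'a topology \<Rightarrow> 'a set set \<Rightarrow> bool" where
  "discrete_family X \<F> \<longleftrightarrow>
    (\<forall>x \<in> topspace X. \<exists>U. openin X U \<and> x \<in> U \<and>
        (\<forall>A \<in> \<F>. \<forall>B \<in> \<F>. A \<inter> U \<noteq> {} \<and> B \<inter> U \<noteq> {} \<longrightarrow> A = B))"

definition moving_off :: "'a topology \<Rightarrow> 'a set set \<Rightarrow> bool" where
  "moving_off X \<F> \<longleftrightarrow>
    (\<forall>F \<in> \<F>. F \<subseteq> topspace X) \<and>
    (\<forall>K. compactin X K \<longrightarrow> (\<exists>F \<in> \<F>. F \<noteq> {} \<and> F \<inter> K = {}))"

definition DMOP :: "'a topology \<Rightarrow> bool" where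
  "DMOP X \<longleftrightarrow>
    (\<forall>\<F>. moving_off X \<F> \<and> (\<forall>F \<in> \<F>. finite F \<and> F \<subseteq> isolated_points X)
       \<longrightarrow> (\<exists>\<G> \<subseteq> \<F>. infinite \<G> \<and> discrete_family X \<G>))"

end

theory Submission
  imports Defs
begin

text \<open>A function \<open>f : X \<rightarrow> {0, 1}\<close> is a clopen set \<open>A = {f = 1}\<close>, and the Fell hypograph
  topology is generated by the conditions "\<open>A\<close> meets the open set \<open>U\<close>" and "\<open>A\<close> misses the
  compact set \<open>K\<close>". Separability provides countably many compact sets with empty interior such
  that every \<open>A\<close> missing all of them consists of isolated points; missing one of them is
  an open dense condition. Hence a generic \<open>A\<close> is a closed discrete set of isolated points, and it
  contains infinitely many disjoint members of any given moving off family, which yields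
  meagerness without \<open>DMOP\<close>. It misses the interior \<open>W\<close> of the set of non-isolated points,
  although meeting \<open>W\<close> is an open condition, dense unless the closure of \<open>W\<close> is compact.

  Conversely, let the closure of \<open>W\<close> be compact. On the open set of all \<open>A\<close> missing it, the
  conditions "\<open>F \<subseteq> A\<close>, \<open>A \<inter> K = {}\<close>" with \<open>F\<close> a finite set of isolated points form a
  \<open>\<pi>\<close>-base. Given open dense sets \<open>D n\<close>, \<open>DMOP\<close> supplies for each such condition a discrete
  sequence of finite sets extending it into the next \<open>D n\<close>. Iterating gives a countable tree of
  finite sets, and a second application of \<open>DMOP\<close> selects one child for each node so that the
  union of all selected sets is still closed and discrete. The branch following the selection
  is a clopen set in all \<open>D n\<close>.\<close>

section \<open>Clopen sets and basic open sets\<close>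

definition one_set :: "'a topology \<Rightarrow> ('a \<Rightarrow> real) \<Rightarrow> 'a set" where
  "one_set X f = {x \<in> topspace X. f x = 1}"

text \<open>For finite families \<open>\<U>\<close> of open sets and compact \<open>K\<close> these
  sets form a base of the function space. They turn conditions on hypographs in the product with the
  line into conditions on clopen subsets of \<open>X\<close>.\<close>

definition hit_miss :: "'a topology \<Rightarrow> 'a set set \<Rightarrow> 'a set \<Rightarrow> ('a \<Rightarrow> real) set" where
  "hit_miss X \<U> K = {f \<in> continuous_funs X {0, 1}.
     (\<forall>U \<in> \<U>. one_set X f \<inter> U \<noteq> {}) \<and> one_set X f \<inter> K = {}}"

lemma hit_miss_mono:
  assumes "\<U>' \<subseteq> \<U>" "K' \<subseteq> K"
  shows "hit_miss X \<U> K \<subseteq> hit_miss X \<U>' K'"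
  using assms unfolding hit_miss_def by blast

lemma continuous_funs_01:
  assumes "f \<in> continuous_funs X {0, 1}" "x \<in> topspace X"
  shows "f x = 0 \<or> f x = 1"
proof -
  have "f x \<in> {0, 1}"
    using assms continuous_map_image_subset_topspace[of X "top_of_set {0,1}" f]
    by (auto simp: continuous_funs_def)
  then show ?thesis by auto
qed

lemma clopen_preimage_01:
  assumes "continuous_map X (top_of_set {0, 1 :: real}) f"
  shows "openin X {x \<in> topspace X. f x \<in> S}" "closedin X {x \<in> topspace X. f x \<in> S}"
proof -
  have eq: "{x \<in> topspace X. f x \<in> S} = {x \<in> topspace X. f x \<in> S \<inter> {0, 1}}"
    using assms continuous_map_image_subset_topspace[OF assms] by auto
  have fin: "finite (S \<inter> {0, 1})" "finite ({0, 1} - S \<inter> {0, 1})" by auto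
  have "closedin (top_of_set {0, 1 :: real}) A" if "A \<subseteq> {0, 1}" for A
    using that by (meson closed_subset finite.emptyI finite.insertI finite_imp_closed finite_subset)
  then have "closedin (top_of_set {0, 1 :: real}) (S \<inter> {0, 1})"
    and "closedin (top_of_set {0, 1 :: real}) ({0, 1} - S \<inter> {0, 1})" by auto
  moreover from this have "openin (top_of_set {0, 1 :: real}) (S \<inter> {0, 1})"
    by (simp add: openin_closedin_eq)
  ultimately show "openin X {x \<in> topspace X. f x \<in> S}" "closedin X {x \<in> topspace X. f x \<in> S}"
    unfolding eq using assms openin_continuous_map_preimage closedin_continuous_map_preimage
    by blast+
qed

lemma clopen_one_set:
  assumes "f \<in> continuous_funs X {0, 1}"
  shows "openin X (one_set X f)" "closedin X (one_set X f)"
  using clopen_preimage_01[of X f "{1}"] assms by (auto simp: continuous_funs_def one_set_def)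

lemma one_set_subset: "one_set X f \<subseteq> topspace X"
  by (auto simp: one_set_def)

lemma continuous_fun_of_clopen:
  assumes "openin X A" "closedin X A"
  obtains f where "f \<in> continuous_funs X {0, 1}" "one_set X f = A"
proof
  have sub: "A \<subseteq> topspace X" using assms openin_subset by auto
  let ?f = "\<lambda>x\<in>topspace X. indicator A x :: real"
  have "openin X {x \<in> topspace X. ?f x \<in> V}" for V
  proof -
    have "{x \<in> topspace X. ?f x \<in> V}
        = (if 1 \<in> V then A else {}) \<union> (if 0 \<in> V then topspace X - A else {})"
      using sub by (auto simp: indicator_def)
    then show ?thesis using assms by (auto intro!: openin_Un)
  qed
  moreover have "?f \<in> topspace X \<rightarrow> {0, 1}" by (auto simp: indicator_def)
  ultimately show "?f \<in> continuous_funs X {0, 1}"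
    by (auto simp: continuous_funs_def continuous_map_def)
  show "one_set X ?f = A"
    using sub by (auto simp: one_set_def indicator_def)
qed

section \<open>The Fell subbase in terms of clopen sets\<close>

text \<open>The hypograph is the part of the product at heights \<open>\<le> 0\<close> together with
  the part over \<open>one_set X f\<close> at heights \<open>\<le> 1\<close>. The strict bound
  \<open>{..<1}\<close> makes the projection an open set; it is harmless because \<open>W\<close> is
  open.\<close>

lemma hypograph_hit_iff:
  assumes "f \<in> continuous_funs X {0, 1}" and W: "openin (prod_topology X euclideanreal) W"
  shows "hypograph X f \<inter> W \<noteq> {} \<longleftrightarrow>
    W \<inter> topspace X \<times> {..0} \<noteq> {} \<or> one_set X f \<inter> fst ` (W \<inter> topspace X \<times> {..<1}) \<noteq> {}"
    (is "_ \<longleftrightarrow> ?R")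
proof
  assume "hypograph X f \<inter> W \<noteq> {}"
  then obtain p where "p \<in> hypograph X f" "p \<in> W" by blast
  then obtain x y where xy: "x \<in> topspace X" "y \<le> f x" "(x, y) \<in> W"
    by (cases p) (auto simp: hypograph_def)
  obtain U V where UV: "openin X U" "open V" "x \<in> U" "y \<in> V" "U \<times> V \<subseteq> W"
    using W xy(3) unfolding openin_prod_topology_alt by (metis open_openin)
  show ?R
  proof (cases "f x = 1")
    case True
    \<comment> \<open>The height \<open>y\<close> may equal 1, so the point is pushed down slightly
      inside \<open>W\<close>.\<close>
    obtain e where "e > 0" "ball y e \<subseteq> V"
      using UV(2,4) open_contains_ball by blast
    then have "y - e / 2 \<in> V" by (auto simp: dist_real_def)
    then have "(x, y - e / 2) \<in> W \<inter> topspace X \<times> {..<1}"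
      using UV xy True \<open>e > 0\<close> by auto
    then have "x \<in> fst ` (W \<inter> topspace X \<times> {..<1})" by force
    then show ?thesis using True xy by (auto simp: one_set_def)
  next
    case False
    then have "y \<le> 0" using xy continuous_funs_01[OF assms(1) xy(1)] by simp
    then have "(x, y) \<in> W \<inter> topspace X \<times> {..0}" using xy by simp
    then show ?thesis by blast
  qed
next
  assume R: ?R
  show "hypograph X f \<inter> W \<noteq> {}"
  proof (cases "W \<inter> topspace X \<times> {..0} = {}")
    case False
    then obtain x y where xy: "(x, y) \<in> W" "x \<in> topspace X" "y \<le> 0" by auto
    have "0 \<le> f x" using continuous_funs_01[OF assms(1) xy(2)] by auto
    then have "(x, y) \<in> hypograph X f \<inter> W" using xy by (simp add: hypograph_def)
    then show ?thesis by blast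
  next
    case True
    then obtain x y where "f x = 1" "x \<in> topspace X" "(x, y) \<in> W" "y < 1"
      using R by (auto simp: one_set_def)
    then have "(x, y) \<in> hypograph X f \<inter> W" by (simp add: hypograph_def)
    then show ?thesis by blast
  qed
qed

text \<open>Same decomposition of the hypograph. Here the bound \<open>{..1}\<close> is closed, so
  that the projection of a compact \<open>K\<close> stays compact.\<close>

lemma hypograph_miss_iff:
  assumes "f \<in> continuous_funs X {0, 1}" and "K \<subseteq> topspace X \<times> UNIV"
  shows "hypograph X f \<inter> K = {} \<longleftrightarrow>
    K \<inter> topspace X \<times> {..0} = {} \<and> one_set X f \<inter> fst ` (K \<inter> topspace X \<times> {..1}) = {}"
    (is "?L \<longleftrightarrow> ?R")
proof
  assume ?L
  then have L: "\<not> y \<le> f x" if "(x, y) \<in> K" for x y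
    using that assms(2) by (auto simp: hypograph_def)
  have n0: "\<not> y \<le> 0" if "(x, y) \<in> K" for x y
  proof -
    have "x \<in> topspace X" using that assms(2) by auto
    then show ?thesis using L[OF that] continuous_funs_01[OF assms(1), of x] by auto
  qed
  show ?R
  proof (intro conjI equals0I)
    fix p assume "p \<in> K \<inter> topspace X \<times> {..0}"
    then show False using n0[of "fst p" "snd p"] by auto
  next
    fix x assume "x \<in> one_set X f \<inter> fst ` (K \<inter> topspace X \<times> {..1})"
    then obtain y where "f x = 1" "(x, y) \<in> K" "y \<le> 1"
      by (auto simp: one_set_def)
    then show False using L[of x y] by simp
  qed
next
  assume ?R
  then have R1: "\<And>x y. (x, y) \<in> K \<Longrightarrow> \<not> y \<le> 0"
    and R2: "\<And>x y. (x, y) \<in> K \<Longrightarrow> y \<le> 1 \<Longrightarrow> x \<notin> one_set X f"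
    using assms(2) by (blast, force)
  have "\<not> y \<le> f x" if "(x, y) \<in> K" "x \<in> topspace X" for x y
    using continuous_funs_01[OF assms(1) that(2)] R1[OF that(1)] R2[OF that(1)] that(2)
    by (simp add: one_set_def) linarith
  then show ?L unfolding hypograph_def by blast
qed

text \<open>Only points of \<open>one_set X f\<close> carry positive heights: meeting
  \<open>U\<close> means that the hypograph meets \<open>U\<close> times the positive half-line, and
  missing \<open>K\<close> means that it misses \<open>K \<times> {1}\<close>.\<close>

lemma openin_hit_miss:
  assumes "finite \<U>" "\<And>U. U \<in> \<U> \<Longrightarrow> openin X U" "compactin X K"
  shows "openin (fell_hypograph_space X {0, 1}) (hit_miss X \<U> K)"
proof -
  let ?T = "fell_hypograph_space X {0, 1}" and ?C = "continuous_funs X {0, 1}"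
  let ?Z = "prod_topology X euclideanreal"
  have hit: "openin ?T {f \<in> ?C. one_set X f \<inter> U \<noteq> {}}" if U: "openin X U" for U
  proof -
    let ?W = "U \<times> {0 :: real <..}"
    have W: "openin ?Z ?W" using U by (simp add: openin_prod_Times_iff)
    have "openin (fell_topology ?Z) {F. closedin ?Z F \<and> F \<inter> ?W \<noteq> {}}"
      unfolding fell_topology_def by (rule topology_generated_by_Basis) (use W in auto)
    moreover have "{f \<in> ?C. one_set X f \<inter> U \<noteq> {}}
        = hypograph X -` {F. closedin ?Z F \<and> F \<inter> ?W \<noteq> {}} \<inter> ?C"
    proof -
      have *: "fst ` (?W \<inter> topspace X \<times> {..<1}) = U"
      proof
        show "U \<subseteq> fst ` (?W \<inter> topspace X \<times> {..<1})"
        proof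
          fix x assume "x \<in> U"
          then show "x \<in> fst ` (?W \<inter> topspace X \<times> {..<1})"
            using openin_subset[OF U] by (intro image_eqI[where x = "(x, 1 / 2 :: real)"]) auto
        qed
      qed auto
      have disj: "{0 :: real <..} \<inter> {..0} = {}" by auto
      have "hypograph X f \<inter> ?W \<noteq> {} \<longleftrightarrow> one_set X f \<inter> U \<noteq> {}" if "f \<in> ?C" for f
        using hypograph_hit_iff[OF that W] unfolding * by (simp add: Times_Int_Times disj)
      then show ?thesis
        by (intro set_eqI) (use closedin_hypograph[of _ X "{0, 1}"] in \<open>simp cong: conj_cong\<close>, metis)
    qed
    ultimately show ?thesis
      unfolding fell_hypograph_space_def openin_pullback_topology by blast
  qed
  have miss: "openin ?T {f \<in> ?C. one_set X f \<inter> K = {}}"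
  proof -
    let ?K = "K \<times> {1 :: real}"
    have K: "compactin ?Z ?K" using assms(3) by (simp add: compactin_Times)
    have Ksub: "K \<subseteq> topspace X" using assms(3) compactin_subset_topspace by auto
    have "openin (fell_topology ?Z) {F. closedin ?Z F \<and> F \<subseteq> topspace ?Z - ?K}"
      unfolding fell_topology_def by (rule topology_generated_by_Basis) (use K in blast)
    moreover have "{f \<in> ?C. one_set X f \<inter> K = {}}
        = hypograph X -` {F. closedin ?Z F \<and> F \<subseteq> topspace ?Z - ?K} \<inter> ?C"
    proof -
      have *: "fst ` (?K \<inter> topspace X \<times> {..1}) = K"
        using Ksub by force
      have "hypograph X f \<inter> ?K = {} \<longleftrightarrow> one_set X f \<inter> K = {}" if "f \<in> ?C" for f
        using hypograph_miss_iff[OF that, of ?K] Ksub unfolding * by (simp add: Times_Int_Times Sigma_mono)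
      moreover have "hypograph X f \<subseteq> topspace ?Z - ?K \<longleftrightarrow> hypograph X f \<inter> ?K = {}" for f
        unfolding hypograph_def by force
      ultimately show ?thesis
        by (intro set_eqI) (use closedin_hypograph[of _ X "{0, 1}"] in \<open>simp cong: conj_cong\<close>, metis)
    qed
    ultimately show ?thesis
      unfolding fell_hypograph_space_def openin_pullback_topology by blast
  qed
  \<comment> \<open>For empty \<open>\<U>\<close> the indexed intersection is \<open>UNIV\<close>;
    the factor \<open>topspace ?T\<close> cuts it down to an open set.\<close>
  have "hit_miss X \<U> K = {f \<in> ?C. one_set X f \<inter> K = {}} \<inter>
      (topspace ?T \<inter> (\<Inter>U\<in>\<U>. {f \<in> ?C. one_set X f \<inter> U \<noteq> {}}))"
    by (auto simp: hit_miss_def topspace_fell_hypograph_space)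
  moreover have "openin ?T \<dots>"
  proof (cases "\<U> = {}")
    case True
    then show ?thesis using miss by (auto intro!: openin_Int)
  next
    case False
    then show ?thesis
      by (intro openin_Int miss openin_topspace openin_Inter) (use assms hit in auto)
  qed
  ultimately show ?thesis by simp
qed

lemma hit_miss_neighbourhood:
  assumes "openin (fell_hypograph_space X {0, 1}) V" "f \<in> V"
  obtains \<U> K where "finite \<U>" "\<And>U. U \<in> \<U> \<Longrightarrow> openin X U" "compactin X K"
    "f \<in> hit_miss X \<U> K" "hit_miss X \<U> K \<subseteq> V"
proof -
  let ?C = "continuous_funs X {0, 1}" and ?Z = "prod_topology X euclideanreal"
  let ?S = "{{F. closedin ?Z F \<and> F \<inter> U \<noteq> {}} | U. openin ?Z U} \<union>
      {{F. closedin ?Z F \<and> F \<subseteq> topspace ?Z - K} | K. compactin ?Z K}"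
  let ?good = "\<lambda>\<U> K. finite \<U> \<and> (\<forall>U\<in>\<U>. openin X U) \<and> compactin X K \<and> f \<in> hit_miss X \<U> K"
  \<comment> \<open>Induction over the generation of the topology from its subbase, with
    \<open>f\<close> fixed; the premise makes the claim local at the hypograph of
    \<open>f\<close>.\<close>
  let ?P = "\<lambda>G. hypograph X f \<in> G \<longrightarrow>
      (\<exists>\<U> K. ?good \<U> K \<and> hypograph X ` hit_miss X \<U> K \<subseteq> G)"
  obtain G where G: "openin (fell_topology ?Z) G" "V = hypograph X -` G \<inter> ?C"
    using assms unfolding fell_hypograph_space_def openin_pullback_topology by blast
  have fC: "f \<in> ?C" using assms(2) G by auto
  have triv: "?good {} {}" using fC by (auto simp: hit_miss_def)
  have "generate_topology_on ?S G"
    using G(1) unfolding fell_topology_def openin_topology_generated_by_iff .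
  then have "?P G"
  proof (induction rule: generate_topology_on.induct)
    case Empty
    then show ?case by simp
  next
    case (Int a b)
    show ?case
    proof
      assume "hypograph X f \<in> a \<inter> b"
      then obtain \<U> K \<U>' K' where *: "?good \<U> K" "hypograph X ` hit_miss X \<U> K \<subseteq> a"
        "?good \<U>' K'" "hypograph X ` hit_miss X \<U>' K' \<subseteq> b"
        using Int by blast
      have "hit_miss X (\<U> \<union> \<U>') (K \<union> K') = hit_miss X \<U> K \<inter> hit_miss X \<U>' K'"
        by (auto simp: hit_miss_def)
      then show "\<exists>\<U> K. ?good \<U> K \<and> hypograph X ` hit_miss X \<U> K \<subseteq> a \<inter> b"
        using * by (intro exI[of _ "\<U> \<union> \<U>'"] exI[of _ "K \<union> K'"]) (auto intro: compactin_Un)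
    qed
  next
    case (UN k)
    then show ?case by (meson Union_iff Union_upper subset_trans)
  next
    case (Basis s)
    show ?case
    proof
      assume fs: "hypograph X f \<in> s"
      from Basis consider (hit) U where "openin ?Z U" "s = {F. closedin ?Z F \<and> F \<inter> U \<noteq> {}}"
        | (miss) K where "compactin ?Z K" "s = {F. closedin ?Z F \<and> F \<subseteq> topspace ?Z - K}"
        by blast
      then show "\<exists>\<U> K. ?good \<U> K \<and> hypograph X ` hit_miss X \<U> K \<subseteq> s"
      proof cases
        case hit
        \<comment> \<open>If \<open>U\<close> reaches heights \<open>\<le> 0\<close>, every
          hypograph meets it and no condition on \<open>one_set X f\<close> arises.\<close>
        show ?thesis
        proof (cases "U \<inter> topspace X \<times> {..0} = {}")
          case False
          then have "hypograph X ` hit_miss X {} {} \<subseteq> s"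
            using hypograph_hit_iff[OF _ hit(1)] closedin_hypograph
            by (fastforce simp: hit_miss_def hit(2))
          then show ?thesis using triv by blast
        next
          case True
          let ?U = "fst ` (U \<inter> topspace X \<times> {..<1})"
          have "openin ?Z (U \<inter> topspace X \<times> {..<1})"
            using hit(1) by (auto intro!: openin_Int simp: openin_prod_Times_iff)
          then have "openin X ?U"
            using open_map_fst by (auto simp: open_map_def)
          moreover have "f \<in> hit_miss X {?U} {}"
            using hypograph_hit_iff[OF fC hit(1)] fs fC True by (auto simp: hit_miss_def hit(2))
          moreover have "hypograph X ` hit_miss X {?U} {} \<subseteq> s"
            using hypograph_hit_iff[OF _ hit(1)] closedin_hypograph
            by (fastforce simp: hit_miss_def hit(2))
          ultimately show ?thesis by (intro exI[of _ "{?U}"] exI[of _ "{}"]) auto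
        qed
      next
        case miss
        let ?K = "fst ` (K \<inter> topspace X \<times> {..1})"
        have Ksub: "K \<subseteq> topspace X \<times> UNIV"
          using compactin_subset_topspace[OF miss(1)] by auto
        have "closedin ?Z (topspace X \<times> {..1})"
          by (simp add: closedin_prod_Times_iff)
        then have "compactin X ?K"
          using miss(1) by (intro image_compactin[OF _ continuous_map_fst] compact_Int_closedin)
        moreover have *: "hypograph X g \<in> s \<longleftrightarrow> hypograph X g \<inter> K = {}" if "g \<in> ?C" for g
          using closedin_hypograph[OF that] closedin_subset[OF closedin_hypograph[OF that]]
          by (auto simp: miss(2))
        moreover have "f \<in> hit_miss X {} ?K"
          using hypograph_miss_iff[OF fC Ksub] fs fC * by (auto simp: hit_miss_def)
        \<comment> \<open>That \<open>K\<close> avoids all heights \<open>\<le> 0\<close> does not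
          depend on the function, so it carries over from \<open>f\<close> to
          \<open>g\<close>.\<close>
        moreover have "hypograph X g \<in> s" if "g \<in> hit_miss X {} ?K" for g
        proof -
          have g: "g \<in> ?C" using that by (auto simp: hit_miss_def)
          then show ?thesis
            using hypograph_miss_iff[OF g Ksub] hypograph_miss_iff[OF fC Ksub] * fs fC that
            by (simp add: hit_miss_def)
        qed
        ultimately show ?thesis by (intro exI[of _ "{}"] exI[of _ ?K]) auto
      qed
    qed
  qed
  then obtain \<U> K where UK: "?good \<U> K" "hypograph X ` hit_miss X \<U> K \<subseteq> G"
    using assms(2) G(2) by blast
  moreover have "hit_miss X \<U> K \<subseteq> V"
    using UK G(2) by (auto simp: hit_miss_def)
  ultimately show thesis using that by blast
qed

section \<open>Clopen sets separating finite sets from compact sets\<close>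

lemma clopen_separation:
  assumes "totally_disconnected_space X" "x \<in> topspace X" "y \<in> topspace X" "x \<noteq> y"
  obtains A where "openin X A" "closedin X A" "x \<in> A" "y \<notin> A"
proof -
  obtain f where f: "continuous_map X (top_of_set {0, 1 :: real}) f" "f x = 1" "f y = 0"
    using assms unfolding totally_disconnected_space_def by blast
  show thesis
    using that[of "{z \<in> topspace X. f z \<in> {1}}"] clopen_preimage_01[OF f(1), of "{1}"] f assms
    by auto
qed

lemma totally_disconnected_imp_Hausdorff:
  assumes "totally_disconnected_space X"
  shows "Hausdorff_space X"
  unfolding Hausdorff_space_def
proof (intro allI impI)
  fix x y assume "x \<in> topspace X \<and> y \<in> topspace X \<and> x \<noteq> y"
  then obtain A where "openin X A" "closedin X A" "x \<in> A" "y \<notin> A" "y \<in> topspace X"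
    using clopen_separation[OF assms] by metis
  then show "\<exists>U V. openin X U \<and> openin X V \<and> x \<in> U \<and> y \<in> V \<and> disjnt U V"
    by (intro exI[of _ A] exI[of _ "topspace X - A"]) (auto simp: disjnt_iff)
qed

text \<open>For one point \<open>x\<close>, finitely many clopen sets omitting \<open>x\<close>
  cover \<open>K\<close>, and the complement of their union separates. Finitely many points are
  handled by a finite union.\<close>

lemma clopen_separation_compact:
  assumes td: "totally_disconnected_space X" and S: "finite S" "S \<subseteq> topspace X"
    and K: "compactin X K" "S \<inter> K = {}"
  obtains A where "openin X A" "closedin X A" "S \<subseteq> A" "A \<inter> K = {}"
proof -
  have pt: "\<exists>A. openin X A \<and> closedin X A \<and> x \<in> A \<and> A \<inter> K = {}" if "x \<in> S" for x
  proof -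
    let ?\<U> = "{A. openin X A \<and> closedin X A \<and> x \<notin> A}"
    have "K \<subseteq> \<Union>?\<U>"
    proof
      fix y assume "y \<in> K"
      then have "y \<in> topspace X" "y \<noteq> x" "x \<in> topspace X"
        using K S that compactin_subset_topspace by blast+
      then show "y \<in> \<Union>?\<U>" using clopen_separation[OF td, of y x] by blast
    qed
    then obtain \<F> where F: "finite \<F>" "\<F> \<subseteq> ?\<U>" "K \<subseteq> \<Union>\<F>"
      using compactinD[OF K(1), of ?\<U>] by auto
    have "openin X (\<Union>\<F>)" "closedin X (\<Union>\<F>)"
      using F by (auto intro!: openin_Union closedin_Union)
    moreover have "x \<notin> \<Union>\<F>" "x \<in> topspace X" using F S that by auto
    ultimately show ?thesis
      by (intro exI[of _ "topspace X - \<Union>\<F>"]) (use F(3) in auto)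
  qed
  then obtain A where A: "\<And>x. x \<in> S \<Longrightarrow> openin X (A x) \<and> closedin X (A x) \<and> x \<in> A x \<and> A x \<inter> K = {}"
    by metis
  show thesis
  proof (rule that)
    show "openin X (\<Union>x\<in>S. A x)" "closedin X (\<Union>x\<in>S. A x)"
      using A S(1) by (auto intro!: openin_Union closedin_Union)
  qed (use A in auto)
qed

text \<open>Pick a point of each \<open>U\<close> outside \<open>K\<close> and separate these
  finitely many points from \<open>K\<close> by a clopen set.\<close>

lemma hit_miss_nonempty:
  assumes td: "totally_disconnected_space X"
    and U: "finite \<U>" "\<And>U. U \<in> \<U> \<Longrightarrow> openin X U \<and> \<not> U \<subseteq> K" and K: "compactin X K"
  shows "hit_miss X \<U> K \<noteq> {}"
proof -
  have "\<forall>U\<in>\<U>. \<exists>x. x \<in> U - K" using U(2) by blast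
  then obtain p where p: "\<And>U. U \<in> \<U> \<Longrightarrow> p U \<in> U - K" by metis
  have "p U \<in> topspace X" if "U \<in> \<U>" for U
    using p[OF that] U(2)[OF that] openin_subset by auto
  then have "p ` \<U> \<subseteq> topspace X" "p ` \<U> \<inter> K = {}"
    using p by auto
  then obtain A where A: "openin X A" "closedin X A" "p ` \<U> \<subseteq> A" "A \<inter> K = {}"
    using clopen_separation_compact[OF td _ _ K] U(1) by (metis finite_imageI)
  obtain f where "f \<in> continuous_funs X {0, 1}" "one_set X f = A"
    using continuous_fun_of_clopen[OF A(1,2)] by metis
  then have "f \<in> hit_miss X \<U> K"
    using A p by (auto simp: hit_miss_def)
  then show ?thesis by auto
qed

section \<open>Meagerness\<close>

text \<open>\<open>X\<close> is not assumed to be Baire, so the category theorem is applied in the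
  closure of the interior of \<open>K\<close>, a compact Hausdorff subspace covered by the closures
  of the nowhere dense pieces.\<close>

lemma meager_compact_interior_empty:
  assumes X: "Hausdorff_space X" and M: "meager_in X M" and K: "compactin X K" "K \<subseteq> M"
  shows "X interior_of K = {}"
proof (rule ccontr)
  assume ne: "X interior_of K \<noteq> {}"
  let ?U = "X interior_of K"
  let ?Y = "subtopology X (X closure_of ?U)"
  obtain N :: "nat \<Rightarrow> 'a set" where N: "\<And>n. nowhere_dense_in X (N n)" "M = (\<Union>n. N n)"
    using M by (auto simp: meager_in_def)
  have "closedin X K" using X K compactin_imp_closedin by blast
  then have clU: "X closure_of ?U \<subseteq> K"
    by (simp add: closure_of_minimal interior_of_subset)
  then have "compactin X (X closure_of ?U)"
    by (meson K(1) closed_compactin closedin_closure_of)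
  then have Y: "compact_space ?Y" by (rule compact_space_subtopology)
  have YH: "Hausdorff_space ?Y" using X by (rule Hausdorff_space_subtopology)
  have Usub: "?U \<subseteq> X closure_of ?U"
    by (simp add: closure_of_subset interior_of_subset_topspace)
  let ?\<G> = "range (\<lambda>n. X closure_of ?U \<inter> X closure_of (N n))"
  have "?Y interior_of \<Union>?\<G> = {}"
  proof (rule Baire_category_alt)
    show "completely_metrizable_space ?Y \<or> locally_compact_space ?Y \<and> regular_space ?Y"
      using Y YH compact_Hausdorff_imp_regular_space compact_imp_locally_compact_space by blast
    fix G assume "G \<in> ?\<G>"
    then obtain n where G: "G = X closure_of ?U \<inter> X closure_of (N n)" by blast
    have "closedin ?Y G"
      unfolding G by (intro closedin_subtopology_Int_closed closedin_closure_of)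
    \<comment> \<open>A non-empty relatively open subset of the closure of \<open>?U\<close> meets
      \<open>?U\<close>, where it is open in \<open>X\<close>; so nowhere density passes to the
      subspace.\<close>
    moreover have "?Y interior_of G = {}"
    proof (rule ccontr)
      assume neG: "?Y interior_of G \<noteq> {}"
      obtain V where V: "openin X V" "?Y interior_of G = V \<inter> X closure_of ?U"
        using openin_interior_of[of ?Y G] unfolding openin_subtopology by metis
      then have "V \<inter> X closure_of ?U \<noteq> {}" using neG by simp
      then have "V \<inter> ?U \<noteq> {}"
        using openin_Int_closure_of_eq_empty[OF V(1)] by blast
      moreover have "V \<inter> ?U \<subseteq> X closure_of (N n)"
        using V(2) interior_of_subset[of ?Y G] Usub by (auto simp: G)
      moreover have "openin X (V \<inter> ?U)" using V(1) by auto
      ultimately have "X interior_of (X closure_of (N n)) \<noteq> {}"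
        using interior_of_maximal by blast
      then show False using N(1)[of n] by (simp add: nowhere_dense_in_def)
    qed
    ultimately show "closedin ?Y G \<and> ?Y interior_of G = {}" by blast
  qed auto
  moreover have "?U \<subseteq> \<Union>?\<G>"
  proof
    fix x assume "x \<in> ?U"
    then obtain n where "x \<in> N n"
      using K(2) N(2) interior_of_subset[of X K] by blast
    moreover have "N n \<subseteq> X closure_of (N n)"
      using N(1)[of n] by (simp add: closure_of_subset nowhere_dense_in_def)
    ultimately show "x \<in> \<Union>?\<G>" using Usub \<open>x \<in> ?U\<close> by blast
  qed
  moreover have "openin ?Y ?U"
    unfolding openin_subtopology using Usub by (intro exI[of _ ?U]) auto
  ultimately show False using ne interior_of_maximal by blast
qed

lemma meager_spaceI:
  fixes D :: "nat \<Rightarrow> 'a set"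
  assumes "\<And>n. openin T (D n)" "\<And>n. T closure_of (D n) = topspace T" "(\<Inter>n. D n) = {}"
  shows "meager_space T"
  unfolding meager_space_def meager_in_def
proof (intro exI[of _ "\<lambda>n. topspace T - D n"] conjI allI)
  fix n
  have "closedin T (topspace T - D n)" using assms(1) by blast
  then show "nowhere_dense_in T (topspace T - D n)"
    using assms(2)[of n]
    by (simp add: nowhere_dense_in_def closure_of_closedin interior_of_complement)
qed (use assms(3) in blast)

lemma meager_spaceE:
  assumes "meager_space T"
  obtains D :: "nat \<Rightarrow> 'a set" where "\<And>n. openin T (D n)"
    "\<And>n. T closure_of (D n) = topspace T" "(\<Inter>n. D n) = {}"
proof -
  obtain N :: "nat \<Rightarrow> 'a set" where N: "\<And>n. nowhere_dense_in T (N n)" "topspace T = (\<Union>n. N n)"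
    using assms by (auto simp: meager_space_def meager_in_def)
  show thesis
  proof (rule that[of "\<lambda>n. topspace T - T closure_of (N n)"])
    show "T closure_of (topspace T - T closure_of (N n)) = topspace T" for n
      using N(1)[of n] by (simp add: closure_of_complement nowhere_dense_in_def)
    have "N n \<subseteq> T closure_of (N n)" for n
      using N(1)[of n] by (simp add: closure_of_subset nowhere_dense_in_def)
    then show "(\<Inter>n. topspace T - T closure_of (N n)) = {}"
      using N(2) by blast
  qed auto
qed

lemma Baire_not_meager:
  assumes "Baire_space T" "topspace T \<noteq> {}"
  shows "\<not> meager_space T"
proof
  assume "meager_space T"
  then obtain D :: "nat \<Rightarrow> 'a set" where "\<And>n. openin T (D n)"
    "\<And>n. T closure_of (D n) = topspace T" "(\<Inter>n. D n) = {}"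
    by (rule meager_spaceE) blast
  then show False using assms unfolding Baire_space_def by (metis closure_of_empty)
qed

section \<open>Separability and generic clopen sets\<close>

text \<open>A clopen set is open in the {0,1}-topology, so missing \<open>M\<close> it also misses
  the {0,1}-closure of \<open>M\<close>.\<close>

lemma one_set_isolated:
  assumes "f \<in> continuous_funs X {0, 1}" "one_set X f \<inter> M = {}"
    and "nonisolated_points X = zero_one_topology X closure_of M"
  shows "one_set X f \<subseteq> isolated_points X"
proof -
  have "openin (zero_one_topology X) {x \<in> topspace X. f x \<in> {1}}"
    unfolding zero_one_topology_def
  proof (rule topology_generated_by_Basis)
    have "openin (top_of_set {0, 1 :: real}) {1}"
      unfolding openin_open by (intro exI[of _ "{0 <..}"]) auto
    then show "{x \<in> topspace X. f x \<in> {1}} \<in> {{x \<in> topspace X. f x \<in> V} | f V.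
        continuous_map X (top_of_set {0, 1 :: real}) f \<and> openin (top_of_set {0, 1}) V}"
      using assms(1) unfolding continuous_funs_def by blast
  qed
  then have "openin (zero_one_topology X) (one_set X f)"
    by (simp add: one_set_def)
  then have "one_set X f \<inter> nonisolated_points X = {}"
    using assms(2,3) openin_Int_closure_of_eq_empty by metis
  then show ?thesis
    using one_set_subset by (fastforce simp: nonisolated_points_def)
qed

text \<open>The form in which separability enters all category arguments below. The
  \<open>H n\<close> have empty interior because they are compact subsets of a meager set.\<close>

lemma zero_one_separable_cover:
  assumes "Hausdorff_space X" "zero_one_separable X"
  obtains H :: "nat \<Rightarrow> 'a set" where "\<And>n. compactin X (H n)" "\<And>n. X interior_of (H n) = {}"
    "\<And>f. \<lbrakk>f \<in> continuous_funs X {0, 1}; \<And>n. one_set X f \<inter> H n = {}\<rbrakk>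
      \<Longrightarrow> one_set X f \<subseteq> isolated_points X"
proof -
  obtain M H where M: "meager_in X M" "nonisolated_points X = zero_one_topology X closure_of M"
    and H: "\<And>n :: nat. compactin X (H n)" "M = (\<Union>n. H n)"
    using assms(2) unfolding zero_one_separable_def sigma_compact_in_def by metis
  show thesis
  proof (rule that[OF H(1)])
    show "X interior_of (H n) = {}" for n
      using meager_compact_interior_empty[OF assms(1) M(1) H(1)[of n]] H(2) by auto
    fix f assume "f \<in> continuous_funs X {0, 1}" "\<And>n. one_set X f \<inter> H n = {}"
    then show "one_set X f \<subseteq> isolated_points X"
      using one_set_isolated[OF _ _ M(2)] H(2) by blast
  qed
qed

lemma open_minus_empty_interior:
  assumes "Hausdorff_space X" "openin X U" "compactin X K" "X interior_of H = {}" "U \<subseteq> K \<union> H"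
  shows "U \<subseteq> K"
proof -
  have "openin X (U - K)" using assms compactin_imp_closedin by blast
  moreover have "U - K \<subseteq> H" using assms by auto
  ultimately have "U - K \<subseteq> X interior_of H" by (simp add: interior_of_maximal)
  then show ?thesis using assms by auto
qed

text \<open>Enlarging the missed set by \<open>H\<close> keeps the condition satisfiable, since an
  open set not inside the compact \<open>K\<close> is not inside \<open>K \<union> H\<close> either.
  Hence missing \<open>H\<close> is a dense condition.\<close>

lemma hit_miss_in_open:
  assumes X: "Hausdorff_space X" and H: "compactin X H" "X interior_of H = {}"
    and V: "openin (fell_hypograph_space X {0, 1}) V" "V \<noteq> {}"
  obtains \<U> K where "finite \<U>" "\<And>U. U \<in> \<U> \<Longrightarrow> openin X U \<and> \<not> U \<subseteq> K"
    "compactin X K" "H \<subseteq> K" "hit_miss X \<U> K \<subseteq> V"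
proof -
  obtain f where "f \<in> V" using V by blast
  then obtain \<U> K where UK: "finite \<U>" "\<And>U. U \<in> \<U> \<Longrightarrow> openin X U" "compactin X K"
    "f \<in> hit_miss X \<U> K" "hit_miss X \<U> K \<subseteq> V"
    using hit_miss_neighbourhood[OF V(1)] by metis
  show thesis
  proof (rule that[of \<U> "K \<union> H"])
    fix U assume U: "U \<in> \<U>"
    then have "\<not> U \<subseteq> K" using UK(4) by (auto simp: hit_miss_def)
    then show "openin X U \<and> \<not> U \<subseteq> K \<union> H"
      using open_minus_empty_interior[OF X _ UK(3) H(2)] UK(2)[OF U] by blast
  next
    show "hit_miss X \<U> (K \<union> H) \<subseteq> V"
      using UK(5) by (auto simp: hit_miss_def)
  qed (use UK H in \<open>auto intro: compactin_Un\<close>)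
qed

lemma interior_nonisolated_disjoint:
  "X interior_of nonisolated_points X \<inter> isolated_points X = {}"
  using interior_of_subset by (fastforce simp: nonisolated_points_def)

text \<open>Meeting the interior of the non-isolated points would be a non-empty open condition,
  while a generic function has only isolated points in its \<open>one_set\<close>.\<close>

lemma Baire_imp_interior_nonisolated_empty:
  assumes td: "totally_disconnected_space X" and sep: "zero_one_separable X"
    and B: "Baire_space (fell_hypograph_space X {0, 1})"
  shows "X interior_of nonisolated_points X = {}"
proof (rule ccontr)
  let ?T = "fell_hypograph_space X {0, 1}" and ?W = "X interior_of nonisolated_points X"
  assume W: "?W \<noteq> {}"
  note X = totally_disconnected_imp_Hausdorff[OF td]
  obtain H :: "nat \<Rightarrow> 'a set" where H: "\<And>n. compactin X (H n)" "\<And>n. X interior_of (H n) = {}"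
    "\<And>f. \<lbrakk>f \<in> continuous_funs X {0, 1}; \<And>n. one_set X f \<inter> H n = {}\<rbrakk>
      \<Longrightarrow> one_set X f \<subseteq> isolated_points X"
    using zero_one_separable_cover[OF X sep] by metis
  have D: "openin ?T (hit_miss X {} (H n))" for n
    using H(1) by (intro openin_hit_miss) auto
  have cl: "?T closure_of (hit_miss X {} (H n)) = topspace ?T" for n
    unfolding dense_intersects_open
  proof (intro allI impI)
    fix V assume V: "openin ?T V \<and> V \<noteq> {}"
    then obtain \<U> K where UK: "finite \<U>" "\<And>U. U \<in> \<U> \<Longrightarrow> openin X U \<and> \<not> U \<subseteq> K"
      "compactin X K" "H n \<subseteq> K" "hit_miss X \<U> K \<subseteq> V"
      using hit_miss_in_open[OF X H(1,2)] by metis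
    then have "hit_miss X \<U> K \<noteq> {}" by (intro hit_miss_nonempty[OF td])
    moreover have "hit_miss X \<U> K \<subseteq> hit_miss X {} (H n)"
      using UK(4) by (auto simp: hit_miss_def)
    ultimately show "hit_miss X {} (H n) \<inter> V \<noteq> {}" using UK(5) by blast
  qed
  have dense: "?T closure_of (\<Inter>n. hit_miss X {} (H n)) = topspace ?T"
    using B[unfolded Baire_space_def, rule_format, of "\<lambda>n. hit_miss X {} (H n)"] D cl by blast
  have "openin ?T (hit_miss X {?W} {})" by (intro openin_hit_miss) auto
  moreover have "hit_miss X {?W} {} \<noteq> {}"
    using W by (intro hit_miss_nonempty[OF td]) auto
  ultimately have "(\<Inter>n. hit_miss X {} (H n)) \<inter> hit_miss X {?W} {} \<noteq> {}"
    using dense[unfolded dense_intersects_open] by simp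
  then obtain f where f: "f \<in> hit_miss X {?W} {}" "\<And>n. f \<in> hit_miss X {} (H n)"
    by blast
  then have "one_set X f \<subseteq> isolated_points X" by (intro H(3)) (auto simp: hit_miss_def)
  then show False using f(1) interior_nonisolated_disjoint[of X] by (auto simp: hit_miss_def)
qed

text \<open>No compact set contains the interior of the non-isolated points, so meeting it can be
  added to any basic condition and is dense; but it is incompatible with missing all
  \<open>H n\<close>.\<close>

lemma noncompact_imp_meager:
  assumes td: "totally_disconnected_space X" and sep: "zero_one_separable X"
    and nc: "\<not> compactin X (X closure_of (X interior_of nonisolated_points X))"
  shows "meager_space (fell_hypograph_space X {0, 1})"
proof -
  let ?T = "fell_hypograph_space X {0, 1}" and ?W = "X interior_of nonisolated_points X"
  note X = totally_disconnected_imp_Hausdorff[OF td]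
  obtain H :: "nat \<Rightarrow> 'a set" where H: "\<And>n. compactin X (H n)" "\<And>n. X interior_of (H n) = {}"
    "\<And>f. \<lbrakk>f \<in> continuous_funs X {0, 1}; \<And>n. one_set X f \<inter> H n = {}\<rbrakk>
      \<Longrightarrow> one_set X f \<subseteq> isolated_points X"
    using zero_one_separable_cover[OF X sep] by metis
  show ?thesis
  proof (rule meager_spaceI)
    show "openin ?T (hit_miss X {?W} (H n))" for n
      using H(1) by (intro openin_hit_miss) auto
    show "?T closure_of (hit_miss X {?W} (H n)) = topspace ?T" for n
      unfolding dense_intersects_open
    proof (intro allI impI)
      fix V assume V: "openin ?T V \<and> V \<noteq> {}"
      then obtain \<U> K where UK: "finite \<U>" "\<And>U. U \<in> \<U> \<Longrightarrow> openin X U \<and> \<not> U \<subseteq> K"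
        "compactin X K" "H n \<subseteq> K" "hit_miss X \<U> K \<subseteq> V"
        using hit_miss_in_open[OF X H(1,2)] by metis
      have "\<not> ?W \<subseteq> K"
      proof
        assume "?W \<subseteq> K"
        then have "X closure_of ?W \<subseteq> K"
          using UK(3) X by (simp add: closure_of_minimal compactin_imp_closedin)
        then show False using nc UK(3) by (meson closed_compactin closedin_closure_of)
      qed
      then have "hit_miss X (insert ?W \<U>) K \<noteq> {}"
        using UK by (intro hit_miss_nonempty[OF td]) auto
      moreover have "hit_miss X (insert ?W \<U>) K \<subseteq> hit_miss X {?W} (H n) \<inter> hit_miss X \<U> K"
        using UK(4) by (auto simp: hit_miss_def)
      ultimately show "hit_miss X {?W} (H n) \<inter> V \<noteq> {}" using UK(5) by blast
    qed
    show "(\<Inter>n. hit_miss X {?W} (H n)) = {}"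
    proof (rule equals0I)
      fix f assume f: "f \<in> (\<Inter>n. hit_miss X {?W} (H n))"
      then have "one_set X f \<subseteq> isolated_points X" by (intro H(3)) (auto simp: hit_miss_def)
      then show False using f interior_nonisolated_disjoint[of X] by (auto simp: hit_miss_def)
    qed
  qed
qed

section \<open>Meagerness from the failure of \<open>DMOP\<close>\<close>

text \<open>Points of \<open>A\<close> have themselves as neighbourhoods; the other points have the
  complement of \<open>A\<close>.\<close>

lemma discrete_family_of_disjoint:
  assumes "openin X A" "closedin X A" "A \<subseteq> isolated_points X" "\<Union>\<G> \<subseteq> A" "disjoint \<G>"
  shows "discrete_family X \<G>"
  unfolding discrete_family_def
proof
  fix x assume x: "x \<in> topspace X"
  show "\<exists>U. openin X U \<and> x \<in> U \<and>
      (\<forall>B\<in>\<G>. \<forall>C\<in>\<G>. B \<inter> U \<noteq> {} \<and> C \<inter> U \<noteq> {} \<longrightarrow> B = C)"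
  proof (cases "x \<in> A")
    case True
    then have "openin X {x}" using assms(3) by (auto simp: isolated_points_def)
    then show ?thesis
      using assms(5) by (intro exI[of _ "{x}"]) (auto simp: disjoint_def)
  next
    case False
    then show ?thesis
      using assms(2,4) x by (intro exI[of _ "topspace X - A"]) blast
  qed
qed

text \<open>Greedy choice: \<open>K\<close> together with the finitely many points already used is
  still compact.\<close>

lemma moving_off_disjoint_subfamily:
  fixes m :: nat
  assumes \<F>: "moving_off X \<F>" "\<And>F. F \<in> \<F> \<Longrightarrow> finite F" and K: "compactin X K"
  obtains \<S> where "\<S> \<subseteq> \<F>" "finite \<S>" "card \<S> = m" "{} \<notin> \<S>" "disjoint \<S>" "\<Union>\<S> \<inter> K = {}"
proof -
  have "\<exists>\<S> \<subseteq> \<F>. finite \<S> \<and> card \<S> = m \<and> {} \<notin> \<S> \<and> disjoint \<S> \<and> \<Union>\<S> \<inter> K = {}"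
  proof (induction m)
    case 0
    show ?case by (intro exI[of _ "{}"]) (simp add: disjoint_def)
  next
    case (Suc m)
    obtain \<S> where S: "\<S> \<subseteq> \<F>" "finite \<S>" "card \<S> = m" "{} \<notin> \<S>" "disjoint \<S>" "\<Union>\<S> \<inter> K = {}"
      using Suc.IH by (elim exE conjE)
    have "finite (\<Union>\<S>)" "\<Union>\<S> \<subseteq> topspace X"
      using S(1,2) \<F> unfolding moving_off_def by (blast intro: finite_Union)+
    then have "compactin X (K \<union> \<Union>\<S>)"
      using K by (simp add: compactin_Un finite_imp_compactin)
    then obtain F where F: "F \<in> \<F>" "F \<noteq> {}" "F \<inter> (K \<union> \<Union>\<S>) = {}"
      using \<F>(1) unfolding moving_off_def by blast
    then have "F \<notin> \<S>" by blast
    moreover have "disjoint (insert F \<S>)"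
      using S(5) F(3) by (auto simp: disjoint_def)
    ultimately show ?case
      using S F by (intro exI[of _ "insert F \<S>"]) auto
  qed
  then show thesis by (elim exE conjE) (rule that)
qed

lemma not_DMOP_imp_meager:
  assumes td: "totally_disconnected_space X" and sep: "zero_one_separable X"
    and "\<not> DMOP X"
  shows "meager_space (fell_hypograph_space X {0, 1})"
proof -
  let ?T = "fell_hypograph_space X {0, 1}" and ?C = "continuous_funs X {0, 1}"
  note X = totally_disconnected_imp_Hausdorff[OF td]
  obtain H :: "nat \<Rightarrow> 'a set" where H: "\<And>n. compactin X (H n)" "\<And>n. X interior_of (H n) = {}"
    "\<And>f. \<lbrakk>f \<in> continuous_funs X {0, 1}; \<And>n. one_set X f \<inter> H n = {}\<rbrakk>
      \<Longrightarrow> one_set X f \<subseteq> isolated_points X"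
    using zero_one_separable_cover[OF X sep] by metis
  obtain \<F> where \<F>: "moving_off X \<F>" "\<And>F. F \<in> \<F> \<Longrightarrow> finite F" "\<And>F. F \<in> \<F> \<Longrightarrow> F \<subseteq> isolated_points X"
    and nd: "\<And>\<G>. \<G> \<subseteq> \<F> \<Longrightarrow> infinite \<G> \<Longrightarrow> \<not> discrete_family X \<G>"
    using assms(3) unfolding DMOP_def by metis
  \<comment> \<open>Membership in \<open>D n\<close> asks for \<open>n\<close> disjoint non-empty
    members of \<open>\<F>\<close> inside the clopen set, and for missing
    \<open>H n\<close>.\<close>
  define Q where "Q n = {\<S>. \<S> \<subseteq> \<F> \<and> finite \<S> \<and> card \<S> = n \<and> {} \<notin> \<S> \<and> disjoint \<S>}" for n :: nat
  define D where "D n = (\<Union>\<S>\<in>Q n. hit_miss X ((\<lambda>x. {x}) ` \<Union>\<S>) (H n))" for n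
  have sing: "finite ((\<lambda>x. {x}) ` \<Union>\<S>)" "\<And>U. U \<in> (\<lambda>x. {x}) ` \<Union>\<S> \<Longrightarrow> openin X U" if "\<S> \<in> Q n" for \<S> n
  proof -
    have S: "finite \<S>" "\<S> \<subseteq> \<F>" using that by (auto simp: Q_def)
    then show "finite ((\<lambda>x. {x}) ` \<Union>\<S>)"
      using \<F>(2) by (intro finite_imageI finite_Union) auto
    fix U assume "U \<in> (\<lambda>x. {x}) ` \<Union>\<S>"
    then obtain x where "U = {x}" "x \<in> \<Union>\<S>" by blast
    then have "x \<in> isolated_points X" using S(2) \<F>(3) by blast
    then show "openin X U" using \<open>U = {x}\<close> by (simp add: isolated_points_def)
  qed
  show ?thesis
  proof (rule meager_spaceI)
    show "openin ?T (D n)" for n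
    proof -
      have "openin ?T (hit_miss X ((\<lambda>x. {x}) ` \<Union>\<S>) (H n))" if "\<S> \<in> Q n" for \<S>
        by (rule openin_hit_miss[OF sing(1)[OF that] sing(2)[OF that] H(1)])
      then show ?thesis unfolding D_def by (intro openin_Union) auto
    qed
    show "?T closure_of (D n) = topspace ?T" for n
      unfolding dense_intersects_open
    proof (intro allI impI)
      fix V assume V: "openin ?T V \<and> V \<noteq> {}"
      then obtain \<U> K where UK: "finite \<U>" "\<And>U. U \<in> \<U> \<Longrightarrow> openin X U \<and> \<not> U \<subseteq> K"
        "compactin X K" "H n \<subseteq> K" "hit_miss X \<U> K \<subseteq> V"
        using hit_miss_in_open[OF X H(1,2)] by metis
      obtain \<S> where S: "\<S> \<in> Q n" "\<Union>\<S> \<inter> K = {}"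
        using moving_off_disjoint_subfamily[OF \<F>(1,2) UK(3), of n] unfolding Q_def by blast
      let ?S = "(\<lambda>x. {x}) ` \<Union>\<S>"
      have "hit_miss X (\<U> \<union> ?S) K \<noteq> {}"
      proof (rule hit_miss_nonempty[OF td _ _ UK(3)])
        show "finite (\<U> \<union> ?S)" using UK(1) sing(1)[OF S(1)] by simp
        fix U assume "U \<in> \<U> \<union> ?S"
        then show "openin X U \<and> \<not> U \<subseteq> K"
          using UK(2) sing(2)[OF S(1)] S(2) by blast
      qed
      then obtain f where "f \<in> hit_miss X (\<U> \<union> ?S) K" by blast
      then have "f \<in> hit_miss X ?S (H n)" "f \<in> hit_miss X \<U> K"
        using hit_miss_mono[of ?S "\<U> \<union> ?S" "H n" K X] hit_miss_mono[of \<U> "\<U> \<union> ?S" K K X] UK(4)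
        by (meson Un_upper1 Un_upper2 order_refl subsetD)+
      then have "f \<in> D n" "f \<in> V" using S(1) UK(5) by (auto simp only: D_def)
      then show "D n \<inter> V \<noteq> {}" by blast
    qed
    show "(\<Inter>n. D n) = {}"
    proof (rule equals0I)
      fix f assume "f \<in> (\<Inter>n. D n)"
      then have f: "f \<in> D n" for n by blast
      have fm: "f \<in> ?C" "one_set X f \<inter> H n = {}" for n
        using f[of n] unfolding D_def hit_miss_def by blast+
      note fC = fm(1)
      have iso: "one_set X f \<subseteq> isolated_points X"
        by (rule H(3)[OF fC fm(2)])
      \<comment> \<open>Pigeonhole: of \<open>card A + 1\<close> disjoint sets inside
        \<open>one_set X f\<close>, at least one misses \<open>A\<close>.\<close>
      have avoid: "\<exists>F\<in>\<F>. F \<noteq> {} \<and> F \<subseteq> one_set X f \<and> F \<inter> A = {}" if "finite A" for A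
      proof (rule ccontr)
        assume neg: "\<not> ?thesis"
        obtain \<S> where S: "\<S> \<in> Q (Suc (card A))" "f \<in> hit_miss X ((\<lambda>x. {x}) ` \<Union>\<S>) (H (Suc (card A)))"
          using f[of "Suc (card A)"] by (auto simp: D_def)
        then have "\<Union>\<S> \<subseteq> one_set X f" by (auto simp: hit_miss_def)
        have "\<exists>a. a \<in> F \<inter> A" if "F \<in> \<S>" for F
        proof -
          have "F \<in> \<F>" "F \<noteq> {}" "F \<subseteq> one_set X f"
            using that S(1) \<open>\<Union>\<S> \<subseteq> one_set X f\<close> by (auto simp: Q_def)
          then show ?thesis using neg by blast
        qed
        then obtain p where p: "\<And>F. F \<in> \<S> \<Longrightarrow> p F \<in> F \<inter> A" by metis
        have "inj_on p \<S>"
        proof (rule inj_onI)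
          fix F G assume FG: "F \<in> \<S>" "G \<in> \<S>" "p F = p G"
          then have "p F \<in> F \<inter> G" using p[of F] p[of G] by auto
          moreover have "disjoint \<S>" using S(1) by (auto simp: Q_def)
          ultimately show "F = G" using FG by (auto simp: disjoint_def)
        qed
        moreover have "p ` \<S> \<subseteq> A" using p by auto
        ultimately have "card \<S> \<le> card A" using that card_inj_on_le by blast
        then show False using S(1) by (auto simp: Q_def)
      qed
      \<comment> \<open>The witnesses of \<open>f \<in> D n\<close> for different \<open>n\<close>
        are unrelated, so an infinite disjoint family is obtained as a maximal one: by
        \<open>avoid\<close>, a finite one could be enlarged.\<close>
      define \<A> where "\<A> = {\<S>. \<S> \<subseteq> \<F> \<and> {} \<notin> \<S> \<and> disjoint \<S> \<and> \<Union>\<S> \<subseteq> one_set X f}"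
      have "\<exists>\<G>\<in>\<A>. \<forall>\<S>\<in>\<A>. \<G> \<subseteq> \<S> \<longrightarrow> \<S> = \<G>"
      proof (rule subset_Zorn_nonempty)
        show "\<A> \<noteq> {}" by (auto simp: \<A>_def intro!: exI[of _ "{}"])
        fix \<C> assume "\<C> \<noteq> {}" and C: "subset.chain \<A> \<C>"
        have "disjoint (\<Union>\<C>)"
          unfolding disjoint_def
        proof (intro ballI impI)
          fix F G assume "F \<in> \<Union>\<C>" "G \<in> \<Union>\<C>" "F \<noteq> G"
          then obtain \<S> where "\<S> \<in> \<C>" "F \<in> \<S>" "G \<in> \<S>"
            using C unfolding subset.chain_def by blast
          then have "disjoint \<S>" using C unfolding subset.chain_def \<A>_def by blast
          then show "F \<inter> G = {}"
            using \<open>F \<in> \<S>\<close> \<open>G \<in> \<S>\<close> \<open>F \<noteq> G\<close> by (auto simp: disjoint_def)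
        qed
        then show "\<Union>\<C> \<in> \<A>"
          using C unfolding subset.chain_def \<A>_def by blast
      qed
      then obtain \<G> where G: "\<G> \<in> \<A>" and max: "\<And>\<S>. \<S> \<in> \<A> \<Longrightarrow> \<G> \<subseteq> \<S> \<Longrightarrow> \<S> = \<G>"
        by blast
      have "infinite \<G>"
      proof
        assume "finite \<G>"
        then have "finite (\<Union>\<G>)" using G \<F>(2) by (auto simp: \<A>_def)
        then obtain F where F: "F \<in> \<F>" "F \<noteq> {}" "F \<subseteq> one_set X f" "F \<inter> \<Union>\<G> = {}"
          using avoid by blast
        then have "insert F \<G> \<in> \<A>"
          using G by (auto simp: \<A>_def disjoint_def)
        then have "F \<in> \<G>" using max by blast
        then show False using F by blast
      qed
      moreover have "discrete_family X \<G>"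
        using G by (intro discrete_family_of_disjoint[OF clopen_one_set[OF fC] iso])
          (auto simp: \<A>_def)
      ultimately show False using nd[of \<G>] G by (auto simp: \<A>_def)
    qed
  qed
qed

section \<open>The Baire property\<close>

lemma discrete_family_mono: "discrete_family X \<G> \<Longrightarrow> \<H> \<subseteq> \<G> \<Longrightarrow> discrete_family X \<H>"
  unfolding discrete_family_def by (meson subsetD)

lemma discrete_familyE:
  assumes "discrete_family X \<G>" "x \<in> topspace X"
  obtains U where "openin X U" "x \<in> U"
    "\<And>A B. A \<in> \<G> \<Longrightarrow> B \<in> \<G> \<Longrightarrow> A \<inter> U \<noteq> {} \<Longrightarrow> B \<inter> U \<noteq> {} \<Longrightarrow> A = B"
proof -
  obtain U where U: "openin X U" "x \<in> U"
    "\<forall>A\<in>\<G>. \<forall>B\<in>\<G>. A \<inter> U \<noteq> {} \<and> B \<inter> U \<noteq> {} \<longrightarrow> A = B"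
    using assms(1)[unfolded discrete_family_def, THEN bspec, OF assms(2)] by (elim exE conjE)
  show thesis by (rule that[OF U(1,2)]) (use U(3) in simp)
qed

lemma discrete_family_disjoint:
  assumes "discrete_family X \<G>" "A \<in> \<G>" "B \<in> \<G>" "x \<in> topspace X" "x \<in> A" "x \<in> B"
  shows "A = B"
proof -
  obtain U where U: "x \<in> U"
    "\<And>A B. A \<in> \<G> \<Longrightarrow> B \<in> \<G> \<Longrightarrow> A \<inter> U \<noteq> {} \<Longrightarrow> B \<inter> U \<noteq> {} \<Longrightarrow> A = B"
    using discrete_familyE[OF assms(1,4)] by metis
  show ?thesis using U(1) assms by (intro U(2)) auto
qed

text \<open>Finitely many open sets, each meeting at most one member of the family, cover
  \<open>K\<close>.\<close>

lemma discrete_family_compact_finite: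
  assumes "discrete_family X \<G>" "compactin X K"
  shows "finite {A \<in> \<G>. A \<inter> K \<noteq> {}}"
proof -
  have Ksub: "K \<subseteq> topspace X" using assms(2) compactin_subset_topspace by auto
  define few where "few U \<longleftrightarrow> (\<forall>A\<in>\<G>. \<forall>B\<in>\<G>. A \<inter> U \<noteq> {} \<and> B \<inter> U \<noteq> {} \<longrightarrow> A = B)" for U
  have "\<exists>U. openin X U \<and> x \<in> U \<and> few U" if "x \<in> topspace X" for x
    using assms(1) that unfolding discrete_family_def few_def by blast
  then have "K \<subseteq> \<Union>{U. openin X U \<and> few U}" using Ksub by blast
  then obtain \<F> where F: "finite \<F>" "\<F> \<subseteq> {U. openin X U \<and> few U}" "K \<subseteq> \<Union>\<F>"
    using compactinD[OF assms(2), of "{U. openin X U \<and> few U}"] by auto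
  have "finite {A \<in> \<G>. A \<inter> U \<noteq> {}}" if "U \<in> \<F>" for U
  proof (cases "\<exists>A\<in>\<G>. A \<inter> U \<noteq> {}")
    case True
    then obtain A where "A \<in> \<G>" "A \<inter> U \<noteq> {}" by blast
    moreover have "few U" using F(2) that by blast
    ultimately have "{A \<in> \<G>. A \<inter> U \<noteq> {}} \<subseteq> {A}" unfolding few_def by blast
    then show ?thesis using finite_subset by blast
  next
    case False
    then have "{A \<in> \<G>. A \<inter> U \<noteq> {}} = {}" by blast
    then show ?thesis by (simp only: finite.emptyI)
  qed
  moreover have "{A \<in> \<G>. A \<inter> K \<noteq> {}} \<subseteq> (\<Union>U\<in>\<F>. {A \<in> \<G>. A \<inter> U \<noteq> {}})"
    using F(3) by blast
  ultimately show ?thesis using F(1) by (meson finite_UN_I finite_subset)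
qed

text \<open>Each point has a neighbourhood containing only finitely many points of \<open>S\<close>,
  and in a Hausdorff space these can be removed.\<close>

lemma closedin_subset_discrete_family:
  assumes X: "Hausdorff_space X" and \<G>: "discrete_family X \<G>" "\<And>F. F \<in> \<G> \<Longrightarrow> finite F"
    and S: "S \<subseteq> \<Union>\<G>" "S \<subseteq> topspace X"
  shows "closedin X S"
proof -
  have "\<exists>T. openin X T \<and> y \<in> T \<and> T \<subseteq> topspace X - S" if y: "y \<in> topspace X - S" for y
  proof -
    obtain U where U: "openin X U" "y \<in> U"
      "\<And>A B. A \<in> \<G> \<Longrightarrow> B \<in> \<G> \<Longrightarrow> A \<inter> U \<noteq> {} \<Longrightarrow> B \<inter> U \<noteq> {} \<Longrightarrow> A = B"
      using discrete_familyE[OF \<G>(1), of y] y by blast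
    have "finite (U \<inter> S)"
    proof (cases "\<exists>B\<in>\<G>. B \<inter> U \<noteq> {}")
      case True
      then obtain B where B: "B \<in> \<G>" "B \<inter> U \<noteq> {}" by blast
      have "U \<inter> S \<subseteq> B"
      proof
        fix x assume x: "x \<in> U \<inter> S"
        then obtain B' where "B' \<in> \<G>" "x \<in> B'" using S(1) by blast
        then have "B' = B" using B x by (intro U(3)) auto
        then show "x \<in> B" using \<open>x \<in> B'\<close> by simp
      qed
      then show ?thesis using \<G>(2)[OF B(1)] finite_subset by blast
    next
      case False
      then have "U \<inter> S = {}" using S(1) by blast
      then show ?thesis by simp
    qed
    then have "closedin X (U \<inter> S)" using X S(2) by (intro closedin_Hausdorff_finite) auto
    then have "openin X (U - U \<inter> S)" using U(1) by blast
    then show ?thesis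
      using U y openin_subset[OF U(1)] by (intro exI[of _ "U - U \<inter> S"]) auto
  qed
  then have "openin X (topspace X - S)" using openin_subopen by blast
  then show ?thesis using S(2) by (simp add: closedin_def)
qed

lemma DMOP_E:
  assumes "DMOP X" "moving_off X \<F>" "\<And>F. F \<in> \<F> \<Longrightarrow> finite F \<and> F \<subseteq> isolated_points X"
  obtains \<G> where "\<G> \<subseteq> \<F>" "infinite \<G>" "discrete_family X \<G>"
proof -
  have "moving_off X \<F> \<and> (\<forall>F\<in>\<F>. finite F \<and> F \<subseteq> isolated_points X)" using assms by simp
  then have "\<exists>\<G>\<subseteq>\<F>. infinite \<G> \<and> discrete_family X \<G>"
    by (rule assms(1)[unfolded DMOP_def, THEN spec, THEN mp])
  then show thesis by (elim exE conjE) (rule that)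
qed

lemma DMOP_sequence:
  assumes "DMOP X" "moving_off X \<F>" "\<And>F. F \<in> \<F> \<Longrightarrow> finite F \<and> F \<subseteq> isolated_points X"
  obtains A :: "nat \<Rightarrow> 'a set" where "inj A" "range A \<subseteq> \<F>" "discrete_family X (range A)"
proof -
  obtain \<G> where G: "\<G> \<subseteq> \<F>" "infinite \<G>" "discrete_family X \<G>"
    using DMOP_E[OF assms] by metis
  obtain A :: "nat \<Rightarrow> 'a set" where A: "inj A" "range A \<subseteq> \<G>"
    using infinite_countable_subset[OF G(2)] by (elim exE conjE)
  show thesis
    using that[OF A(1) subset_trans[OF A(2) G(1)] discrete_family_mono[OF G(3) A(2)]] .
qed

text \<open>The moving off family consists of finite sets containing one selected set for each of the
  first \<open>n\<close> indices. The marker \<open>x n\<close> makes \<open>n\<close> unbounded on every infinite discrete subfamily.\<close>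

lemma DMOP_selection:
  fixes A :: "'i :: countable \<Rightarrow> nat \<Rightarrow> 'a set"
  assumes X: "Hausdorff_space X" and "DMOP X"
    and fin: "\<And>s i. finite (A s i)" and ne: "\<And>s i. A s i \<noteq> {}"
    and iso: "\<And>s i. A s i \<subseteq> isolated_points X"
    and inj: "\<And>s. inj (A s)" and disc: "\<And>s. discrete_family X (range (A s))"
  obtains \<iota> where "\<And>S. S \<subseteq> (\<Union>s. A s (\<iota> s)) \<Longrightarrow> closedin X S"
proof -
  have isoX: "isolated_points X \<subseteq> topspace X" by (auto simp: isolated_points_def)
  have avoid: "\<exists>i. A s i \<inter> K = {}" if K: "compactin X K" for s K
  proof (rule ccontr)
    assume "\<nexists>i. A s i \<inter> K = {}"
    then have "range (A s) \<subseteq> {B \<in> range (A s). B \<inter> K \<noteq> {}}" by blast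
    then have "finite (range (A s))"
      using discrete_family_compact_finite[OF disc K] finite_subset by blast
    then show False using inj finite_imageD by blast
  qed
  \<comment> \<open>The index \<open>undefined\<close> is just some fixed element of
    \<open>'i\<close>; a compact set misses \<open>A undefined n\<close> for some \<open>n\<close>,
    and with it the marker \<open>x n\<close>.\<close>
  define x where "x n = (SOME y. y \<in> A undefined n)" for n
  have x: "x n \<in> A undefined n" for n
    unfolding x_def using ne by (simp add: some_in_eq)
  define \<B> where "\<B> = {B. finite B \<and> B \<subseteq> isolated_points X \<and>
      (\<exists>n. x n \<in> B \<and> (\<forall>s. to_nat s < n \<longrightarrow> (\<exists>i. A s i \<subseteq> B)))}"
  have "moving_off X \<B>"
    unfolding moving_off_def
  proof (intro conjI ballI allI impI)
    fix B assume "B \<in> \<B>"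
    then show "B \<subseteq> topspace X" using isoX by (auto simp: \<B>_def)
  next
    fix K assume K: "compactin X K"
    obtain i where i: "\<And>s. A s (i s) \<inter> K = {}" using avoid[OF K] by metis
    obtain n where n: "A undefined n \<inter> K = {}" using avoid[OF K] by blast
    define B where "B = insert (x n) (\<Union>s\<in>{s. to_nat s < n}. A s (i s))"
    have "finite {s :: 'i. to_nat s < n}"
      using finite_vimageI[OF finite_lessThan[of n] inj_to_nat] by (simp add: vimage_def)
    then have "finite B" using fin by (simp add: B_def)
    moreover have "B \<subseteq> isolated_points X" using x iso by (auto simp: B_def)
    ultimately have "B \<in> \<B>" by (auto simp: \<B>_def B_def)
    moreover have "B \<inter> K = {}" using x[of n] n i by (auto simp: B_def)
    moreover have "B \<noteq> {}" by (simp add: B_def)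
    ultimately show "\<exists>F\<in>\<B>. F \<noteq> {} \<and> F \<inter> K = {}" by (intro bexI[of _ B] conjI)
  qed
  moreover have \<B>: "finite B \<and> B \<subseteq> isolated_points X" if "B \<in> \<B>" for B
    using that by (simp add: \<B>_def)
  ultimately obtain \<G> where G: "\<G> \<subseteq> \<B>" "infinite \<G>" "discrete_family X \<G>"
    using DMOP_E[OF \<open>DMOP X\<close>] by metis
  have "\<exists>n. x n \<in> B \<and> (\<forall>s. to_nat s < n \<longrightarrow> (\<exists>i. A s i \<subseteq> B))" if "B \<in> \<G>" for B
    using that G(1) by (auto simp: \<B>_def)
  then obtain n where n: "\<And>B. B \<in> \<G> \<Longrightarrow> x (n B) \<in> B"
    "\<And>B s. B \<in> \<G> \<Longrightarrow> to_nat s < n B \<Longrightarrow> \<exists>i. A s i \<subseteq> B"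
    by metis
  have xX: "x m \<in> topspace X" for m using x iso isoX by blast
  \<comment> \<open>Members with equal \<open>n\<close> share the point \<open>x n\<close> and so
    coincide by discreteness. Hence \<open>n\<close> is unbounded on \<open>\<G>\<close> and every
    index \<open>s\<close> is eventually served.\<close>
  have "inj_on n \<G>"
  proof (rule inj_onI)
    fix B B' assume "B \<in> \<G>" "B' \<in> \<G>" "n B = n B'"
    then show "B = B'"
      using discrete_family_disjoint[OF G(3), of B B' "x (n B)"] n(1)[of B] n(1)[of B'] xX by simp
  qed
  then have inf: "infinite (n ` \<G>)" using G(2) finite_imageD by blast
  have "\<exists>i. A s i \<subseteq> \<Union>\<G>" for s
  proof -
    obtain B where "B \<in> \<G>" "to_nat s < n B"
      using inf unfolding infinite_nat_iff_unbounded by blast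
    then show ?thesis using n(2) by blast
  qed
  \<comment> \<open>All selected sets lie in the union of a single discrete family of finite sets,
    every subset of which is closed.\<close>
  then obtain \<iota> where \<iota>: "\<And>s. A s (\<iota> s) \<subseteq> \<Union>\<G>" by metis
  show thesis
  proof (rule that)
    fix S assume S: "S \<subseteq> (\<Union>s. A s (\<iota> s))"
    have "S \<subseteq> \<Union>\<G>" using S \<iota> by blast
    moreover have "S \<subseteq> topspace X" using S iso isoX by blast
    ultimately show "closedin X S"
      using closedin_subset_discrete_family[OF X G(3)] G(1) \<B> by blast
  qed
qed

lemma openin_subset_isolated:
  assumes "S \<subseteq> isolated_points X"
  shows "openin X S"
proof -
  have "openin X (\<Union>x\<in>S. {x})"
    using assms by (intro openin_Union) (auto simp: isolated_points_def)
  then show ?thesis by simp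
qed

section \<open>Conditions and their cones\<close>

text \<open>A pair \<open>(F, K)\<close> prescribes points of the clopen set and forbids a compact
  set. With the closure inside \<open>K\<close>, every non-empty open set disjoint from
  \<open>K\<close> contains an isolated point, so hitting an open set can be replaced by containing
  an isolated point.\<close>

definition fell_condition :: "'a topology \<Rightarrow> 'a set \<times> 'a set \<Rightarrow> bool" where
  "fell_condition X p \<longleftrightarrow> finite (fst p) \<and> fst p \<subseteq> isolated_points X \<and> compactin X (snd p) \<and>
     X closure_of (X interior_of nonisolated_points X) \<subseteq> snd p \<and> fst p \<inter> snd p = {}"

definition fell_cone :: "'a topology \<Rightarrow> 'a set \<times> 'a set \<Rightarrow> ('a \<Rightarrow> real) set" where
  "fell_cone X p = {f \<in> continuous_funs X {0, 1}.
     fst p \<subseteq> one_set X f \<and> one_set X f \<inter> snd p = {}}"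

lemma openin_fell_cone:
  assumes "finite F" "F \<subseteq> isolated_points X" "compactin X K"
  shows "openin (fell_hypograph_space X {0, 1}) (fell_cone X (F, K))"
proof -
  have "fell_cone X (F, K) = hit_miss X ((\<lambda>x. {x}) ` F) K"
    by (auto simp: fell_cone_def hit_miss_def)
  moreover have "openin X U" if "U \<in> (\<lambda>x. {x}) ` F" for U
    using that assms(2) by (intro openin_subset_isolated) auto
  ultimately show ?thesis
    using openin_hit_miss[OF finite_imageI[OF assms(1)] _ assms(3)] by simp
qed

lemma finite_isolated_clopen:
  assumes "Hausdorff_space X" "finite F" "F \<subseteq> isolated_points X"
  obtains f where "f \<in> continuous_funs X {0, 1}" "one_set X f = F"
proof -
  have "closedin X F"
    using assms by (intro closedin_Hausdorff_finite) (auto simp: isolated_points_def)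
  then show thesis
    using continuous_fun_of_clopen[OF openin_subset_isolated[OF assms(3)]] that by metis
qed

lemma isolated_point_in_open:
  assumes "openin X U" "U \<noteq> {}" "U \<inter> X closure_of (X interior_of nonisolated_points X) = {}"
  shows "U \<inter> isolated_points X \<noteq> {}"
proof
  assume "U \<inter> isolated_points X = {}"
  then have "U \<subseteq> nonisolated_points X"
    using openin_subset[OF assms(1)] by (auto simp: nonisolated_points_def)
  then have "U \<subseteq> X interior_of nonisolated_points X"
    using assms(1) by (simp add: interior_of_maximal)
  also have "\<dots> \<subseteq> X closure_of (X interior_of nonisolated_points X)"
    by (simp add: closure_of_subset interior_of_subset_topspace)
  finally show False using assms by blast
qed

text \<open>Each open set \<open>U\<close> to be hit is replaced by an isolated point of
  \<open>U \<inter> one_set X f\<close>, which exists because this open set is non-empty and misses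
  \<open>K\<close>.\<close>

lemma fell_cone_refine:
  assumes X: "Hausdorff_space X" and V: "openin (fell_hypograph_space X {0, 1}) V" "f \<in> V"
    and p: "fell_condition X (F, K)" "f \<in> fell_cone X (F, K)"
  obtains F' K' where "F \<subseteq> F'" "K \<subseteq> K'" "fell_condition X (F', K')" "fell_cone X (F', K') \<subseteq> V"
proof -
  obtain \<U> H where UH: "finite \<U>" "\<And>U. U \<in> \<U> \<Longrightarrow> openin X U" "compactin X H"
    "f \<in> hit_miss X \<U> H" "hit_miss X \<U> H \<subseteq> V"
    using hit_miss_neighbourhood[OF V] by metis
  have fC: "f \<in> continuous_funs X {0, 1}" and fK: "F \<subseteq> one_set X f" "one_set X f \<inter> K = {}"
    using p(2) by (auto simp: fell_cone_def)
  have fH: "one_set X f \<inter> H = {}" using UH(4) by (simp add: hit_miss_def)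
  have CK: "X closure_of (X interior_of nonisolated_points X) \<subseteq> K"
    using p(1) by (simp add: fell_condition_def)
  have "\<exists>x. x \<in> U \<inter> one_set X f \<inter> isolated_points X" if "U \<in> \<U>" for U
  proof -
    have "openin X (U \<inter> one_set X f)"
      using UH(2)[OF that] clopen_one_set(1)[OF fC] by blast
    moreover have "U \<inter> one_set X f \<noteq> {}"
      using UH(4) that unfolding hit_miss_def by blast
    ultimately show ?thesis
      using isolated_point_in_open[of X "U \<inter> one_set X f"] CK fK(2) by blast
  qed
  then obtain q where q: "\<And>U. U \<in> \<U> \<Longrightarrow> q U \<in> U \<inter> one_set X f \<inter> isolated_points X"
    by metis
  show thesis
  proof (rule that[of "F \<union> q ` \<U>" "K \<union> H"])
    have "q ` \<U> \<subseteq> one_set X f \<inter> isolated_points X" using q by blast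
    then have "F \<union> q ` \<U> \<subseteq> one_set X f" "F \<union> q ` \<U> \<subseteq> isolated_points X"
      using p(1) fK(1) by (auto simp: fell_condition_def)
    moreover from this have "(F \<union> q ` \<U>) \<inter> (K \<union> H) = {}"
      using fK(2) fH by blast
    moreover have "compactin X (K \<union> H)" "finite (F \<union> q ` \<U>)"
      using p(1) UH by (auto simp: fell_condition_def intro: compactin_Un)
    ultimately show "fell_condition X (F \<union> q ` \<U>, K \<union> H)"
      using CK by (auto simp: fell_condition_def)
    have "fell_cone X (F \<union> q ` \<U>, K \<union> H) \<subseteq> hit_miss X \<U> H"
    proof
      fix g assume g: "g \<in> fell_cone X (F \<union> q ` \<U>, K \<union> H)"
      have "one_set X g \<inter> U \<noteq> {}" if "U \<in> \<U>" for U
      proof -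
        have "q U \<in> one_set X g" using g that by (auto simp: fell_cone_def)
        then show ?thesis using q[OF that] by blast
      qed
      then show "g \<in> hit_miss X \<U> H"
        using g by (auto simp: fell_cone_def hit_miss_def)
    qed
    then show "fell_cone X (F \<union> q ` \<U>, K \<union> H) \<subseteq> V" using UH(5) by blast
  qed auto
qed

text \<open>The cone is open and contains the function with \<open>one_set\<close> equal to
  \<open>F\<close>, so the dense set \<open>D\<close> meets it; refine at a common point.\<close>

lemma fell_cone_extend:
  assumes X: "Hausdorff_space X" and p: "fell_condition X (F, K)"
    and D: "openin (fell_hypograph_space X {0, 1}) D"
      "fell_hypograph_space X {0, 1} closure_of D = topspace (fell_hypograph_space X {0, 1})"
  obtains F' K' where "F \<subseteq> F'" "K \<subseteq> K'" "fell_condition X (F', K')" "fell_cone X (F', K') \<subseteq> D"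
proof -
  obtain g where g: "g \<in> continuous_funs X {0, 1}" "one_set X g = F"
    using finite_isolated_clopen[OF X] p by (auto simp: fell_condition_def)
  have "openin (fell_hypograph_space X {0, 1}) (fell_cone X (F, K))"
    using p by (intro openin_fell_cone) (auto simp: fell_condition_def)
  moreover have "g \<in> fell_cone X (F, K)"
    using g p by (auto simp: fell_cone_def fell_condition_def)
  ultimately have "D \<inter> fell_cone X (F, K) \<noteq> {}"
    using D(2)[unfolded dense_intersects_open] by blast
  then obtain f where "f \<in> D" "f \<in> fell_cone X (F, K)" by blast
  then show thesis using fell_cone_refine[OF X D(1) _ p] that by metis
qed

text \<open>\<open>DMOP\<close> is applied to all finite increments \<open>A\<close> that lead from
  the given condition into \<open>D\<close>. They move off compact sets \<open>L\<close> because
  \<open>L\<close> can be forbidden before extending.\<close>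

lemma fell_cone_extend_sequence:
  assumes X: "Hausdorff_space X" and "DMOP X" and nc: "\<not> compact_space X"
    and p: "fell_condition X (F, K)"
    and D: "openin (fell_hypograph_space X {0, 1}) D"
      "fell_hypograph_space X {0, 1} closure_of D = topspace (fell_hypograph_space X {0, 1})"
  obtains A L :: "nat \<Rightarrow> 'a set" where "inj A" "discrete_family X (range A)"
    "\<And>i. finite (A i)" "\<And>i. A i \<noteq> {}" "\<And>i. A i \<subseteq> isolated_points X" "\<And>i. K \<subseteq> L i"
    "\<And>i. fell_condition X (F \<union> A i, L i)" "\<And>i. fell_cone X (F \<union> A i, L i) \<subseteq> D"
proof -
  let ?C = "X closure_of (X interior_of nonisolated_points X)"
  have F: "finite F" "F \<subseteq> isolated_points X" and K: "compactin X K" "?C \<subseteq> K" "F \<inter> K = {}"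
    using p by (auto simp: fell_condition_def)
  define \<F> where "\<F> = {A. finite A \<and> A \<noteq> {} \<and> A \<subseteq> isolated_points X \<and>
      (\<exists>L. K \<subseteq> L \<and> fell_condition X (F \<union> A, L) \<and> fell_cone X (F \<union> A, L) \<subseteq> D)}"
  have "moving_off X \<F>"
    unfolding moving_off_def
  proof (intro conjI ballI allI impI)
    fix B assume "B \<in> \<F>"
    then show "B \<subseteq> topspace X" by (auto simp: \<F>_def isolated_points_def)
  next
    fix L assume L: "compactin X L"
    let ?Q = "K \<union> L \<union> F"
    have "compactin X F" using F by (intro finite_imp_compactin) (auto simp: isolated_points_def)
    then have Q: "compactin X ?Q" using K(1) L by (simp add: compactin_Un)
    \<comment> \<open>Otherwise the complement of \<open>?Q\<close> is an open set without isolated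
      points that misses the closure, hence empty, and \<open>X\<close> would be compact. The point
      \<open>x\<close> obtained from this makes the increment non-empty.\<close>
    have "\<not> isolated_points X \<subseteq> ?Q"
    proof
      assume sub: "isolated_points X \<subseteq> ?Q"
      have "openin X (topspace X - ?Q)" using Q X compactin_imp_closedin by blast
      then have "topspace X - ?Q = {}"
        using isolated_point_in_open[of X "topspace X - ?Q"] sub K(2) by blast
      then have "?Q = topspace X" using compactin_subset_topspace[OF Q] by blast
      then show False using nc Q by (simp add: compact_space_def)
    qed
    then obtain x where x: "x \<in> isolated_points X" "x \<notin> ?Q" by blast
    \<comment> \<open>\<open>L\<close> may meet \<open>F\<close>, so only \<open>L - F\<close> is
      forbidden; it is compact because \<open>F\<close> is open. The new points
      \<open>F' - F\<close> then avoid all of \<open>L\<close>.\<close>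
    have "closedin X (topspace X - F)" using openin_subset_isolated[OF F(2)] by blast
    then have "compactin X ((topspace X - F) \<inter> L)" using L by (rule closed_Int_compactin)
    moreover have "(topspace X - F) \<inter> L = L - F" using compactin_subset_topspace[OF L] by blast
    ultimately have "compactin X (K \<union> (L - F))" using K(1) by (simp add: compactin_Un)
    then have "fell_condition X (insert x F, K \<union> (L - F))"
      using x F K by (auto simp: fell_condition_def)
    then obtain F' K' where FK': "insert x F \<subseteq> F'" "K \<union> (L - F) \<subseteq> K'" "fell_condition X (F', K')"
      "fell_cone X (F', K') \<subseteq> D"
      using fell_cone_extend[OF X _ D] by metis
    have FF: "F \<union> (F' - F) = F'" using FK'(1) by blast
    have *: "finite F'" "F' \<subseteq> isolated_points X" "F' \<inter> K' = {}"
      using FK'(3) by (auto simp: fell_condition_def)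
    have "x \<in> F' - F" using x FK'(1) by blast
    then have "F' - F \<in> \<F>"
      unfolding \<F>_def using * FK' FF by (auto intro!: exI[of _ K'])
    moreover have "(F' - F) \<inter> L = {}" using *(3) FK'(2) by blast
    moreover have "F' - F \<noteq> {}" using \<open>x \<in> F' - F\<close> by blast
    ultimately show "\<exists>F\<in>\<F>. F \<noteq> {} \<and> F \<inter> L = {}" by (intro bexI[of _ "F' - F"] conjI)
  qed
  moreover have "finite A \<and> A \<subseteq> isolated_points X" if "A \<in> \<F>" for A
    using that by (simp add: \<F>_def)
  ultimately obtain A :: "nat \<Rightarrow> 'a set"
    where A: "inj A" "range A \<subseteq> \<F>" "discrete_family X (range A)"
    by (rule DMOP_sequence[OF \<open>DMOP X\<close>])
  have A\<F>: "A i \<in> \<F>" for i using A(2) by blast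
  have "\<exists>L. K \<subseteq> L \<and> fell_condition X (F \<union> A i, L) \<and> fell_cone X (F \<union> A i, L) \<subseteq> D" for i
    using A\<F>[of i] by (simp add: \<F>_def)
  then obtain L where L: "\<And>i. K \<subseteq> L i" "\<And>i. fell_condition X (F \<union> A i, L i)"
    "\<And>i. fell_cone X (F \<union> A i, L i) \<subseteq> D"
    by metis
  have "finite (A i)" "A i \<noteq> {}" "A i \<subseteq> isolated_points X" for i
    using A\<F>[of i] by (auto simp: \<F>_def)
  then show thesis using that[OF A(1,3) _ _ _ L] by simp
qed

section \<open>The tree of conditions and its branch\<close>

text \<open>A node is the list of child numbers leading to it, latest first, so
  \<open>length s\<close> is its depth. Nodes thus form a countable type and can serve as indices in
  \<open>DMOP_selection\<close>.\<close>

primrec tree_position :: "(nat \<Rightarrow> 'p \<Rightarrow> nat \<Rightarrow> 'p) \<Rightarrow> 'p \<Rightarrow> nat list \<Rightarrow> 'p" where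
  "tree_position \<sigma> p [] = p"
| "tree_position \<sigma> p (i # s) = \<sigma> (length s) (tree_position \<sigma> p s) i"

lemma continuous_funs_eqI:
  assumes "f \<in> continuous_funs X {0, 1}" "g \<in> continuous_funs X {0, 1}" "one_set X f = one_set X g"
  shows "f = g"
proof (rule extensionalityI)
  fix x assume x: "x \<in> topspace X"
  then have "f x = 1 \<longleftrightarrow> g x = 1" using assms(3) by (auto simp: one_set_def set_eq_iff)
  then show "f x = g x" using continuous_funs_01[OF assms(1) x] continuous_funs_01[OF assms(2) x] by auto
qed (use assms in \<open>auto simp: continuous_funs_def\<close>)

text \<open>\<open>DMOP\<close> is vacuous for compact \<open>X\<close>, but then every finite set of isolated points is an
  isolated point of the function space.\<close>

lemma fell_cone_meets_Inter_compact:
  fixes D :: "nat \<Rightarrow> ('a \<Rightarrow> real) set"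
  assumes X: "Hausdorff_space X" and c: "compact_space X" and p: "fell_condition X (F, K)"
    and D: "\<And>n. openin (fell_hypograph_space X {0, 1}) (D n)"
      "\<And>n. fell_hypograph_space X {0, 1} closure_of (D n) = topspace (fell_hypograph_space X {0, 1})"
  shows "fell_cone X (F, K) \<inter> (\<Inter>n. D n) \<noteq> {}"
proof -
  have F: "finite F" "F \<subseteq> isolated_points X" "F \<inter> K = {}"
    using p by (auto simp: fell_condition_def)
  obtain g where g: "g \<in> continuous_funs X {0, 1}" "one_set X g = F"
    using finite_isolated_clopen[OF X F(1,2)] by metis
  \<comment> \<open>Forbidding the whole complement of \<open>F\<close> leaves \<open>g\<close> as
    the only element of the cone, so every dense \<open>D n\<close> contains
    \<open>g\<close>.\<close>
  have "compactin X (topspace X - F)"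
    using c openin_subset_isolated[OF F(2)] by (intro closedin_compact_space) auto
  then have "openin (fell_hypograph_space X {0, 1}) (fell_cone X (F, topspace X - F))"
    using F by (intro openin_fell_cone)
  moreover have "g \<in> fell_cone X (F, topspace X - F)" using g by (auto simp: fell_cone_def)
  ultimately have ne: "D n \<inter> fell_cone X (F, topspace X - F) \<noteq> {}" for n
    using D(2)[of n, unfolded dense_intersects_open] by blast
  have "g \<in> D n" for n
  proof -
    obtain h where h: "h \<in> D n" "h \<in> fell_cone X (F, topspace X - F)" using ne[of n] by blast
    then have hC: "h \<in> continuous_funs X {0, 1}" and "one_set X h = F"
      using one_set_subset[of X h] by (auto simp: fell_cone_def)
    then have "h = g" using continuous_funs_eqI[OF hC g(1)] g(2) by simp
    then show ?thesis using h by simp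
  qed
  moreover have "g \<in> fell_cone X (F, K)" using g F by (auto simp: fell_cone_def)
  ultimately show ?thesis by blast
qed

text \<open>Along an arbitrary descending sequence of conditions the union of the finite parts need
  not be closed. So all continuations are kept in a tree, children are selected at all nodes at once
  with closed union, and only then is a branch followed.\<close>

lemma fell_cone_meets_Inter:
  fixes D :: "nat \<Rightarrow> ('a \<Rightarrow> real) set"
  assumes X: "Hausdorff_space X" and "DMOP X" and p: "fell_condition X p0"
    and D: "\<And>n. openin (fell_hypograph_space X {0, 1}) (D n)"
      "\<And>n. fell_hypograph_space X {0, 1} closure_of (D n) = topspace (fell_hypograph_space X {0, 1})"
  shows "fell_cone X p0 \<inter> (\<Inter>n. D n) \<noteq> {}"
proof (cases "compact_space X")
  case True
  then show ?thesis
    using fell_cone_meets_Inter_compact[OF X True, of "fst p0" "snd p0" D] p D by simp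
next
  case False
  let ?P = "\<lambda>n p A L. inj A \<and> discrete_family X (range A) \<and> (\<forall>i. finite (A i)) \<and>
      (\<forall>i. A i \<noteq> {}) \<and> (\<forall>i. A i \<subseteq> isolated_points X) \<and> (\<forall>i. snd p \<subseteq> L i) \<and>
      (\<forall>i. fell_condition X (fst p \<union> A i, L i)) \<and> (\<forall>i. fell_cone X (fst p \<union> A i, L i) \<subseteq> D n)"
  \<comment> \<open>Stated as an implication so that \<open>a\<close> and \<open>l\<close> become
    total functions by choice; outside conditions their values are arbitrary.\<close>
  have "\<forall>n p. \<exists>A L :: nat \<Rightarrow> 'a set. fell_condition X p \<longrightarrow> ?P n p A L"
  proof (intro allI)
    fix n p
    show "\<exists>A L :: nat \<Rightarrow> 'a set. fell_condition X p \<longrightarrow> ?P n p A L"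
    proof (cases "fell_condition X p")
      case True
      then have "fell_condition X (fst p, snd p)" by simp
      from fell_cone_extend_sequence[OF X \<open>DMOP X\<close> False this D(1)[of n] D(2)[of n]]
      obtain A L :: "nat \<Rightarrow> 'a set" where "?P n p A L" by metis
      then show ?thesis by blast
    qed simp
  qed
  then obtain a l :: "nat \<Rightarrow> 'a set \<times> 'a set \<Rightarrow> nat \<Rightarrow> 'a set" where
    al: "\<And>n p. fell_condition X p \<Longrightarrow> ?P n p (a n p) (l n p)"
    unfolding choice_iff by blast
  define pos where "pos = tree_position (\<lambda>n p i. (fst p \<union> a n p i, l n p i)) p0"
  define A where "A s = a (length s) (pos s)" for s
  define L where "L s = l (length s) (pos s)" for s
  have pos0: "pos [] = p0" by (simp add: pos_def)
  have posS: "pos (i # s) = (fst (pos s) \<union> A s i, L s i)" for i s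
    by (simp add: pos_def A_def L_def)
  have cond: "fell_condition X (pos s)" for s
  proof (induction s)
    case Nil
    then show ?case using p by (simp add: pos0)
  next
    case (Cons i s)
    then show ?case using al by (simp add: posS A_def L_def)
  qed
  note alA = al[OF cond, of "length s" s for s, folded A_def L_def]
  obtain \<iota> where \<iota>: "\<And>S. S \<subseteq> (\<Union>s. A s (\<iota> s)) \<Longrightarrow> closedin X S"
    using DMOP_selection[OF X \<open>DMOP X\<close>, of A] alA by metis
  \<comment> \<open>\<open>b k\<close> is the node at depth \<open>k\<close> of the branch that
    obeys the selection \<open>\<iota>\<close>.\<close>
  define b where "b = rec_nat [] (\<lambda>_ s. \<iota> s # s)"
  have b: "b 0 = []" "b (Suc k) = \<iota> (b k) # b k" for k by (simp_all add: b_def)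
  have len: "length (b k) = k" for k by (induction k) (simp_all add: b)
  define F where "F k = fst (pos (b k))" for k
  define K where "K k = snd (pos (b k))" for k
  have FS: "F (Suc k) = F k \<union> A (b k) (\<iota> (b k))" for k by (simp add: F_def b posS)
  have KS: "K k \<subseteq> K (Suc k)" for k using alA[of "b k"] by (simp add: K_def b posS)
  have Fmono: "F k \<subseteq> F m" if "k \<le> m" for k m
    using that by (rule lift_Suc_mono_le[of F, rotated]) (simp add: FS)
  have Kmono: "K k \<subseteq> K m" if "k \<le> m" for k m
    using that by (rule lift_Suc_mono_le[of K, rotated]) (rule KS)
  have disj: "F k \<inter> K k = {}" and finF: "finite (F k)" and isoF: "F k \<subseteq> isolated_points X" for k
    using cond[of "b k"] by (auto simp: fell_condition_def F_def K_def)
  \<comment> \<open>Both sequences increase, so the two sets can be compared at the later of the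
    stages \<open>k\<close> and \<open>m\<close>.\<close>
  have FK: "F m \<inter> K k = {}" for k m
    using disj[of k] disj[of m] Fmono[of m k] Kmono[of k m] by (cases "m \<le> k") auto
  define E where "E = (\<Union>k. F k)"
  have "F k \<subseteq> F 0 \<union> (\<Union>k. A (b k) (\<iota> (b k)))" for k
    by (induction k) (auto simp: FS)
  \<comment> \<open>Apart from the finite set \<open>F 0\<close>, \<open>E\<close> consists of
    selected sets, which makes it closed.\<close>
  then have E: "E = F 0 \<union> (\<Union>k. A (b k) (\<iota> (b k)))"
    unfolding E_def using FS by blast
  have "closedin X (F 0)"
    using X finF isoF[of 0] by (intro closedin_Hausdorff_finite) (auto simp: isolated_points_def)
  moreover have "closedin X (\<Union>k. A (b k) (\<iota> (b k)))" by (rule \<iota>) blast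
  ultimately have "closedin X E" unfolding E by (rule closedin_Un)
  moreover have "openin X E" using isoF by (intro openin_subset_isolated) (auto simp: E_def)
  ultimately obtain g where g: "g \<in> continuous_funs X {0, 1}" "one_set X g = E"
    using continuous_fun_of_clopen by metis
  have cone: "g \<in> fell_cone X (pos (b k))" for k
    using g FK[of _ k] by (auto simp: fell_cone_def E_def F_def K_def)
  \<comment> \<open>The step out of the node at depth \<open>n\<close> enters \<open>D n\<close>,
    hence the cone at depth \<open>Suc n\<close>.\<close>
  have "g \<in> D n" for n
    using cone[of "Suc n"] alA[of "b n"] by (auto simp: b posS len)
  moreover have "g \<in> fell_cone X p0" using cone[of 0] by (simp add: b pos0)
  ultimately show ?thesis by blast
qed

theorem corollary1p16:
  fixes X :: "'a topology"
  assumes "totally_disconnected_space X"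
    and "zero_one_separable X"
  shows "(Baire_space (fell_hypograph_space X {0, 1}) \<longleftrightarrow>
            DMOP X \<and> X interior_of nonisolated_points X = {})
    \<and> (meager_space (fell_hypograph_space X {0, 1}) \<longleftrightarrow>
         \<not> DMOP X \<or> \<not> compactin X (X closure_of (X interior_of nonisolated_points X)))
    \<and> (\<not> Baire_space (fell_hypograph_space X {0, 1}) \<and>
       \<not> meager_space (fell_hypograph_space X {0, 1}) \<longleftrightarrow>
         DMOP X \<and> compactin X (X closure_of (X interior_of nonisolated_points X)) \<and>
         X closure_of (X interior_of nonisolated_points X) \<noteq> {})"
proof -
  let ?T = "fell_hypograph_space X {0, 1}" and ?W = "X interior_of nonisolated_points X"
  note X = totally_disconnected_imp_Hausdorff[OF assms(1)]
  \<comment> \<open>The zero function makes the function space non-empty; an empty space would be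
    both Baire and meager.\<close>
  obtain z where z: "z \<in> continuous_funs X {0, 1}" "one_set X z = {}"
    using continuous_fun_of_clopen[of X "{}"] by auto
  have ne: "topspace ?T \<noteq> {}" using z by (auto simp: topspace_fell_hypograph_space)
  have clW: "X closure_of ?W = {} \<longleftrightarrow> ?W = {}"
    by (simp add: closure_of_eq_empty interior_of_subset_topspace)
  have nonmeager: "\<not> meager_space ?T" if "DMOP X" "compactin X (X closure_of ?W)"
  proof
    assume "meager_space ?T"
    then obtain D :: "nat \<Rightarrow> ('a \<Rightarrow> real) set" where D: "\<And>n. openin ?T (D n)"
      "\<And>n. ?T closure_of (D n) = topspace ?T" "(\<Inter>n. D n) = {}"
      by (rule meager_spaceE) blast
    have "fell_condition X ({}, X closure_of ?W)" using that(2) by (simp add: fell_condition_def)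
    then have "fell_cone X ({}, X closure_of ?W) \<inter> (\<Inter>n. D n) \<noteq> {}"
      using D(1,2) by (intro fell_cone_meets_Inter[OF X that(1)])
    then show False using D(3) by simp
  qed
  have Baire: "Baire_space ?T" if "DMOP X" "?W = {}"
    unfolding Baire_space_def
  proof (intro allI impI)
    fix D :: "nat \<Rightarrow> ('a \<Rightarrow> real) set"
    assume D: "\<forall>n. openin ?T (D n) \<and> ?T closure_of (D n) = topspace ?T"
    show "?T closure_of (\<Inter>n. D n) = topspace ?T"
      unfolding dense_intersects_open
    proof (intro allI impI)
      fix V assume V: "openin ?T V \<and> V \<noteq> {}"
      then obtain f where f: "f \<in> V" by blast
      then have "f \<in> continuous_funs X {0, 1}"
        using V openin_subset topspace_fell_hypograph_space by blast
      \<comment> \<open>With \<open>?W\<close> empty, \<open>({}, {})\<close> is a condition whose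
        cone is the whole space, so every non-empty open set contains the cone of a
        condition.\<close>
      then have "f \<in> fell_cone X ({}, {})" by (simp add: fell_cone_def)
      moreover have "fell_condition X ({}, {})" using that(2) by (simp add: fell_condition_def)
      ultimately obtain F K where FK: "fell_condition X (F, K)" "fell_cone X (F, K) \<subseteq> V"
        using fell_cone_refine[OF X _ f] V by metis
      have "fell_cone X (F, K) \<inter> (\<Inter>n. D n) \<noteq> {}"
        using D by (intro fell_cone_meets_Inter[OF X that(1) FK(1)]) auto
      then show "(\<Inter>n. D n) \<inter> V \<noteq> {}" using FK(2) by blast
    qed
  qed
  \<comment> \<open>An empty \<open>?W\<close> has compact closure; the three equivalences now
    follow propositionally.\<close>
  have "compactin X (X closure_of ?W)" if "?W = {}" using that by simp
  then show ?thesis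
    using nonmeager Baire Baire_not_meager[OF _ ne] clW noncompact_imp_meager[OF assms]
      not_DMOP_imp_meager[OF assms] Baire_imp_interior_nonisolated_empty[OF assms]
    by argo
qed

end
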